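(* Let $K$ be a field and let $G$ be a finite graph on the vertex set $[n]=\{1,\ldots,n\}$ which may have loops, but not parallel edges. Let $I(G)\subset R=K[x_1,\ldots,x_n]$ be its edge ideal, and let $\mathbf{\Gamma}$ be the set of non-trivial primitive even closed walks of $G$. Then the conductor of $I(G)$ is \[ C(I(G))=I(G)+\bigcap_{\Gamma\in\mathbf{\Gamma}}N_\Gamma , \] where the intersection is understood to be $R$ if $\mathbf{\Gamma}=\emptyset$.
   Context: All rings are commutative with unit. The edge ideal of $G$ is $I(G)=(x_ix_j : \{i,j\}\in E(G))$; a loop at $i$ contributes the generator $x_i^2$. Vertices $i,j$ are adjacent if $\{i,j\}\in E(G)$ (so $i$ is adjacent to itself exactly when there is a loop at $i$). Let $E(G)=\{e_1,\ldots,e_m\}$ and let $y_1,\ldots,y_m$ be variables, $y_k$ corresponding to $e_k$. An even closed walk of length $2q>0$ of $G$ is a non-empty sequence of edges of $G$ of the form $\Gamma=\{\{j_1,j_2\},\{j_2,j_3\},\ldots,\{j_{2q-1},j_{2q}\},\{j_{2q},j_1\}\}$ (repetitions allowed); its vertices are $j_1,\ldots,j_{2q}$. Writing $\Gamma=\{e_{i_1},e_{i_2},\ldots,e_{i_{2q}}\}$, set $h_\Gamma^+=\prod_{k=1}^{q}y_{i_{2k-1}}$, $h_\Gamma^-=\prod_{k=1}^{q}y_{i_{2k}}$ and $h_\Gamma=h_\Gamma^+-h_\Gamma^-$. The walk $\Gamma$ is primitive if there is no even closed walk $\Gamma'$ with $h_{\Gamma'}\neq h_\Gamma$ such that $h_{\Gamma'}^+$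 divides $h_\Gamma^+$ and $h_{\Gamma'}^-$ divides $h_\Gamma^-$. The walk $\Gamma$ is trivial if $h_\Gamma=0$. For $\Gamma\in\mathbf{\Gamma}$ set $N_\Gamma=(x_i : i \text{ is adjacent to some vertex in }\Gamma)\subseteq R$ (in particular $x_i\in N_\Gamma$ for every vertex $i$ of $\Gamma$). For a Noetherian ring $R$ and an ideal $I=(f_1,\ldots,f_m)\subseteq R$, let $\mathcal{R}(I)=R[f_1t,\ldots,f_mt]\subseteq R[t]$ be the Rees algebra, $T=R[y_1,\ldots,y_m]$ a polynomial ring, $\varphi:T\to\mathcal{R}(I)$ the $R$-algebra homomorphism with $\varphi(y_j)=f_jt$, and $J=\ker\varphi$. Let $L\subseteq J$ be the ideal of $T$ generated by all linear relations $\sum_{i=1}^m a_iy_i$ with $a_i\in R$ and $\sum_i a_if_i=0$. Then $T/L\cong S(I)$ is the symmetric algebra of $I$, and the kernel of the canonical epimorphism $\alpha:S(I)\to\mathcal{R}(I)$ is $J/L$. The conductor of $I$ is the ideal $C(I)=L:_RJ=\{r\in R: rJ\subseteq L\}=\mathrm{Ann}_R(\ker\alpha)$ of $R$; it does not depend on the chosen generators. *)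

theory Defs
  imports
    "HOL-Algebra.QuotRing"
    "HOL-Algebra.Generated_Rings"
    "HOL-Library.Poly_Mapping"
    "HOL-Computational_Algebra.Polynomial"
begin

section \<open>Subrings of type-class rings as ring structures\<close>

text \<open>All rings below are subsets of a type in \<^class>\<open>comm_ring_1\<close>, closed under the operations of
  that type, so that the number of variables of a polynomial ring can be a parameter. Ideals, sums
  of ideals and kernels are those of the ring structure built here; in particular the coefficients
  of an ideal generated in it range over the carrier \<open>A\<close> only.\<close>

definition ring_on :: "'a::comm_ring_1 set \<Rightarrow> 'a ring" where
  "ring_on A = \<lparr>carrier = A, monoid.mult = (*), one = 1, ring.zero = 0, ring.add = (+)\<rparr>"

lemma ring_on_simps [simp]:
  "carrier (ring_on A) = A"
  "x \<otimes>\<^bsub>ring_on A\<^esub> y = x * y"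
  "\<one>\<^bsub>ring_on A\<^esub> = 1"
  "\<zero>\<^bsub>ring_on A\<^esub> = 0"
  "x \<oplus>\<^bsub>ring_on A\<^esub> y = x + y"
  by (simp_all add: ring_on_def)

lemma cring_ring_onI:
  assumes "0 \<in> A" "1 \<in> A"
    and "\<And>x y. x \<in> A \<Longrightarrow> y \<in> A \<Longrightarrow> x + y \<in> A"
    and "\<And>x. x \<in> A \<Longrightarrow> - x \<in> A"
    and "\<And>x y. x \<in> A \<Longrightarrow> y \<in> A \<Longrightarrow> x * y \<in> A"
  shows "cring (ring_on A)"
proof (rule cringI)
  show "abelian_group (ring_on A)"
  proof (rule abelian_groupI)
    fix x assume "x \<in> carrier (ring_on A)"
    then show "\<exists>y\<in>carrier (ring_on A). y \<oplus>\<^bsub>ring_on A\<^esub> x = \<zero>\<^bsub>ring_on A\<^esub>"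
      using assms(4) by (auto intro!: bexI[of _ "- x"])
  qed (use assms in \<open>auto simp: algebra_simps\<close>)
  show "comm_monoid (ring_on A)"
    by (rule comm_monoidI) (use assms in \<open>auto simp: algebra_simps\<close>)
qed (auto simp: algebra_simps)

section \<open>Multivariate polynomials\<close>

text \<open>A monomial is its finitely supported exponent vector, a polynomial its finitely supported
  family of coefficients; multiplication of \<^type>\<open>poly_mapping\<close> is convolution.\<close>

type_synonym ('i, 'a) mpoly = "('i \<Rightarrow>\<^sub>0 nat) \<Rightarrow>\<^sub>0 'a"

definition const :: "'a::comm_ring_1 \<Rightarrow> ('i, 'a) mpoly" where
  "const a = Poly_Mapping.single 0 a"

definition var :: "'i \<Rightarrow> ('i, 'a::comm_ring_1) mpoly" where
  "var i = Poly_Mapping.single (Poly_Mapping.single i 1) 1"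

text \<open>The polynomial ring over \<open>A\<close> in the variables indexed by \<open>V\<close>.\<close>

definition mpolys :: "'i set \<Rightarrow> 'a::comm_ring_1 set \<Rightarrow> ('i, 'a) mpoly set" where
  "mpolys V A = {p. \<forall>\<alpha> \<in> Poly_Mapping.keys p.
      Poly_Mapping.keys \<alpha> \<subseteq> V \<and> Poly_Mapping.lookup p \<alpha> \<in> A}"

section \<open>Rees algebra, linear relations and the conductor\<close>

text \<open>The Rees algebra \<open>A[f\<^sub>1 t, \<dots>, f\<^sub>m t]\<close>, as a subring of the polynomials in \<open>t\<close>.\<close>

definition rees_algebra :: "'a::comm_ring_1 set \<Rightarrow> nat \<Rightarrow> (nat \<Rightarrow> 'a) \<Rightarrow> 'a poly set" where
  "rees_algebra A m f =
     generate_ring (ring_on UNIV) ({[:a:] | a. a \<in> A} \<union> {monom (f i) 1 | i. i \<in> {1..m}})"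

text \<open>The \<open>A\<close>-algebra homomorphism with \<open>y\<^sub>j \<mapsto> f\<^sub>j t\<close>, written out on coefficients.\<close>

definition rees_hom :: "(nat \<Rightarrow> 'a::comm_ring_1) \<Rightarrow> (nat, 'a) mpoly \<Rightarrow> 'a poly" where
  "rees_hom f F = (\<Sum>\<alpha> \<in> Poly_Mapping.keys F.
      [:Poly_Mapping.lookup F \<alpha>:] *
      (\<Prod>j \<in> Poly_Mapping.keys \<alpha>. monom (f j) 1 ^ Poly_Mapping.lookup \<alpha> j))"

definition rees_kernel :: "'a::comm_ring_1 set \<Rightarrow> nat \<Rightarrow> (nat \<Rightarrow> 'a) \<Rightarrow> (nat, 'a) mpoly set" where
  "rees_kernel A m f =
     a_kernel (ring_on (mpolys {1..m} A)) (ring_on (rees_algebra A m f)) (rees_hom f)"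

definition linear_relations :: "'a::comm_ring_1 set \<Rightarrow> nat \<Rightarrow> (nat \<Rightarrow> 'a) \<Rightarrow> (nat, 'a) mpoly set" where
  "linear_relations A m f = Idl\<^bsub>ring_on (mpolys {1..m} A)\<^esub>
     {(\<Sum>i\<in>{1..m}. const (a i) * var i) | a. (\<forall>i\<in>{1..m}. a i \<in> A) \<and> (\<Sum>i\<in>{1..m}. a i * f i) = 0}"

text \<open>The conductor \<open>L :\<^sub>A J\<close> of the ideal generated by \<open>f\<^sub>1, \<dots>, f\<^sub>m\<close> in the ring \<open>A\<close>. It depends
  on that ideal only, but is defined through the given generators.\<close>

definition conductor :: "'a::comm_ring_1 set \<Rightarrow> nat \<Rightarrow> (nat \<Rightarrow> 'a) \<Rightarrow> 'a set" where
  "conductor A m f =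
     {r \<in> A. \<forall>F \<in> rees_kernel A m f. const r * F \<in> linear_relations A m f}"

section \<open>Graphs with loops and their edge ideals\<close>

text \<open>An edge is the set of its end points, so a loop at \<open>i\<close> is the singleton \<open>{i, i} = {i}\<close>, and
  there are no parallel edges.\<close>

definition loop_graph :: "nat \<Rightarrow> nat set set \<Rightarrow> bool" where
  "loop_graph n E \<longleftrightarrow> (\<forall>e\<in>E. \<exists>i\<in>{1..n}. \<exists>j\<in>{1..n}. e = {i, j})"

definition vertex_ring :: "nat \<Rightarrow> (nat, 'k::field) mpoly ring" where
  "vertex_ring n = ring_on (mpolys {1..n} UNIV)"

definition edge_ideal :: "nat \<Rightarrow> nat set set \<Rightarrow> (nat, 'k::field) mpoly set" where
  "edge_ideal n E = Idl\<^bsub>vertex_ring n\<^esub> {var i * var j | i j. {i, j} \<in> E}"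

section \<open>Even closed walks\<close>

text \<open>Walks are sequences of edges; \<open>js\<close> lists the vertices \<open>j\<^sub>1, \<dots>, j\<^sub>2\<^sub>q\<close>.\<close>

definition even_closed_walk :: "nat set set \<Rightarrow> nat set list \<Rightarrow> bool" where
  "even_closed_walk E \<Gamma> \<longleftrightarrow> set \<Gamma> \<subseteq> E \<and>
     (\<exists>js. js \<noteq> [] \<and> even (length js) \<and>
        \<Gamma> = map (\<lambda>k. {js ! k, js ! (Suc k mod length js)}) [0..<length js])"

text \<open>Every end point of an edge \<open>{j\<^sub>k, j\<^sub>k\<^sub>+\<^sub>1}\<close> is one of the \<open>j\<close>'s and conversely, so the vertex
  set of a walk does not depend on the choice of \<open>js\<close>.\<close>

definition walk_vertices :: "nat set list \<Rightarrow> nat set" where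
  "walk_vertices \<Gamma> = \<Union>(set \<Gamma>)"

text \<open>The variables \<open>y\<close> are indexed by the edges themselves. List positions start at 0, so the
  positive part collects the even positions. The coefficient type \<open>'a\<close> of the polynomials
  has to be passed explicitly where it does not occur in the type of the result.\<close>

definition walk_plus :: "nat set list \<Rightarrow> (nat set, 'a::comm_ring_1) mpoly" where
  "walk_plus \<Gamma> = (\<Prod>k<length \<Gamma> div 2. var (\<Gamma> ! (2 * k)))"

definition walk_minus :: "nat set list \<Rightarrow> (nat set, 'a::comm_ring_1) mpoly" where
  "walk_minus \<Gamma> = (\<Prod>k<length \<Gamma> div 2. var (\<Gamma> ! (2 * k + 1)))"

definition walk_binomial :: "nat set list \<Rightarrow> (nat set, 'a::comm_ring_1) mpoly" where
  "walk_binomial \<Gamma> = walk_plus \<Gamma> - walk_minus \<Gamma>"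

definition primitive_walk :: "'a::comm_ring_1 itself \<Rightarrow> nat set set \<Rightarrow> nat set list \<Rightarrow> bool" where
  "primitive_walk _ E \<Gamma> \<longleftrightarrow> even_closed_walk E \<Gamma> \<and>
     \<not> (\<exists>\<Gamma>'. even_closed_walk E \<Gamma>' \<and>
          (walk_binomial \<Gamma>' :: (nat set, 'a) mpoly) \<noteq> walk_binomial \<Gamma> \<and>
          (walk_plus \<Gamma>' :: (nat set, 'a) mpoly) dvd walk_plus \<Gamma> \<and>
          (walk_minus \<Gamma>' :: (nat set, 'a) mpoly) dvd walk_minus \<Gamma>)"

definition trivial_walk :: "'a::comm_ring_1 itself \<Rightarrow> nat set list \<Rightarrow> bool" where
  "trivial_walk _ \<Gamma> \<longleftrightarrow> (walk_binomial \<Gamma> :: (nat set, 'a) mpoly) = 0"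

definition nontrivial_primitive_walks :: "'a::comm_ring_1 itself \<Rightarrow> nat set set \<Rightarrow> nat set list set" where
  "nontrivial_primitive_walks T E = {\<Gamma>. primitive_walk T E \<Gamma> \<and> \<not> trivial_walk T \<Gamma>}"

definition neighbour_ideal :: "nat \<Rightarrow> nat set set \<Rightarrow> nat set list \<Rightarrow> (nat, 'k::field) mpoly set" where
  "neighbour_ideal n E \<Gamma> =
     Idl\<^bsub>vertex_ring n\<^esub> {var i | i. i \<in> {1..n} \<and> (\<exists>v\<in>walk_vertices \<Gamma>. {i, v} \<in> E)}"

end

theory Submission
  imports Defs "HOL-Library.Multiset"
begin

text \<open>The conductor depends only on the ideal, so the generators may be taken to be the edge
  monomials \<open>x\<^sub>i x\<^sub>j\<close>, with the variables \<open>y\<close> indexed by the edges. Modulo the linear relations \<open>L\<close>,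
  a factor \<open>y\<^sub>e\<close> may be exchanged for \<open>y\<^sub>e'\<close> whenever the factor in the \<open>x\<close> is adjusted to keep the image
  fixed. Such exchanges reduce every binomial of \<open>J\<close> to one without \<open>x\<close>, that is, to a pair of edge
  multisets with equal degrees; alternating walks split it into binomials \<open>h\<^sub>\<Gamma>\<close> with \<open>\<Gamma>\<close> primitive.
  Exchanging along \<open>\<Gamma>\<close> shows that edge monomials and neighbours of \<open>\<Gamma>\<close> multiply \<open>h\<^sub>\<Gamma>\<close> into \<open>L\<close>.
  Conversely, if \<open>\<Sum> a\<^sub>e x\<^sub>e = 0\<close> with \<open>x\<^sub>e\<close> the monomial of the edge \<open>e\<close>, then \<open>a\<^sub>e\<close> lies in \<open>I(G) + N\<^sub>\<Gamma>\<close>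
  for every edge \<open>e\<close> of \<open>\<Gamma>\<close>; so the coefficient of \<open>h\<^sub>\<Gamma>\<^sup>+\<close> in any element of \<open>L\<close> lies there too,
  and for \<open>r h\<^sub>\<Gamma>\<close> this coefficient is \<open>r\<close>. Finally \<open>\<Inter>(I(G) + N\<^sub>\<Gamma>) = I(G) + \<Inter>N\<^sub>\<Gamma>\<close> as the
  ideals are monomial.\<close>

section \<open>Subrings and their ideals\<close>

text \<open>Polynomial rings over such a subset are again instances (\<open>subring_mpolys\<close>),
  so the same ideal arithmetic serves for the vertex ring and for the polynomial ring in the
  \<open>y\<close> over it.\<close>

locale subring_on =
  fixes A :: "'a::comm_ring_1 set"
  assumes zero_in: "0 \<in> A"
    and one_in: "1 \<in> A"
    and add_in: "x \<in> A \<Longrightarrow> y \<in> A \<Longrightarrow> x + y \<in> A"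
    and uminus_in: "x \<in> A \<Longrightarrow> - x \<in> A"
    and mult_in: "x \<in> A \<Longrightarrow> y \<in> A \<Longrightarrow> x * y \<in> A"
begin

lemma diff_in: "x \<in> A \<Longrightarrow> y \<in> A \<Longrightarrow> x - y \<in> A"
  using add_in[of x "- y"] uminus_in[of y] by simp

lemma sum_in: "(\<And>i. i \<in> S \<Longrightarrow> g i \<in> A) \<Longrightarrow> sum g S \<in> A"
  by (induction S rule: infinite_finite_induct) (auto intro: zero_in add_in)

lemma prod_in: "(\<And>i. i \<in> S \<Longrightarrow> g i \<in> A) \<Longrightarrow> prod g S \<in> A"
  by (induction S rule: infinite_finite_induct) (auto intro: one_in mult_in)

lemma power_in: "x \<in> A \<Longrightarrow> x ^ k \<in> A"
  by (induction k) (auto intro: one_in mult_in)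

lemma cring: "cring (ring_on A)"
  by (rule cring_ring_onI) (auto intro: zero_in one_in add_in uminus_in mult_in)

lemma a_inv_eq: "x \<in> A \<Longrightarrow> \<ominus>\<^bsub>ring_on A\<^esub> x = - x"
proof -
  assume x: "x \<in> A"
  interpret cring "ring_on A" by (rule cring)
  show ?thesis
    using x uminus_in[OF x] by (intro minus_equality) auto
qed

lemma idealI_on:
  assumes "Q \<subseteq> A" "0 \<in> Q" "\<And>x y. x \<in> Q \<Longrightarrow> y \<in> Q \<Longrightarrow> x + y \<in> Q"
    and "\<And>a x. a \<in> A \<Longrightarrow> x \<in> Q \<Longrightarrow> a * x \<in> Q"
  shows "ideal Q (ring_on A)"
proof -
  interpret cring "ring_on A" by (rule cring)
  have neg: "- x \<in> Q" if "x \<in> Q" for x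
    using assms(4)[OF uminus_in[OF one_in] that] by simp
  have "subgroup Q (add_monoid (ring_on A))"
  proof (rule add.subgroupI)
    fix x assume x: "x \<in> Q"
    then have "\<ominus>\<^bsub>ring_on A\<^esub> x = - x" using assms(1) by (auto intro: a_inv_eq)
    then show "\<ominus>\<^bsub>ring_on A\<^esub> x \<in> Q" using neg[OF x] by simp
  qed (use assms in auto)
  moreover have "x * a \<in> Q" if "x \<in> Q" "a \<in> A" for a x
    using assms(4)[OF that(2,1)] by (simp add: mult.commute)
  ultimately show ?thesis
    using assms(4) by (intro idealI ring_axioms) auto
qed

lemma ideal_subset: "ideal Q (ring_on A) \<Longrightarrow> x \<in> Q \<Longrightarrow> x \<in> A"
  using ideal.Icarr by fastforce

lemma ideal_zero: "ideal Q (ring_on A) \<Longrightarrow> 0 \<in> Q"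
  using additive_subgroup.zero_closed[OF ideal.axioms(1)] by fastforce

lemma ideal_add: "ideal Q (ring_on A) \<Longrightarrow> x \<in> Q \<Longrightarrow> y \<in> Q \<Longrightarrow> x + y \<in> Q"
  using additive_subgroup.a_closed[OF ideal.axioms(1)] by fastforce

lemma ideal_mult: "ideal Q (ring_on A) \<Longrightarrow> a \<in> A \<Longrightarrow> x \<in> Q \<Longrightarrow> a * x \<in> Q"
  using ideal.I_l_closed by fastforce

lemma ideal_uminus: "ideal Q (ring_on A) \<Longrightarrow> x \<in> Q \<Longrightarrow> - x \<in> Q"
  using ideal_mult[of Q "- 1" x] uminus_in[OF one_in] by simp

lemma ideal_diff: "ideal Q (ring_on A) \<Longrightarrow> x \<in> Q \<Longrightarrow> y \<in> Q \<Longrightarrow> x - y \<in> Q"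
  using ideal_add[of Q x "- y"] ideal_uminus[of Q y] by simp

lemma ideal_sum: "ideal Q (ring_on A) \<Longrightarrow> (\<And>i. i \<in> S \<Longrightarrow> g i \<in> Q) \<Longrightarrow> sum g S \<in> Q"
  by (induction S rule: infinite_finite_induct) (auto intro: ideal_zero ideal_add)

lemma ideal_Idl: "S \<subseteq> A \<Longrightarrow> ideal (Idl\<^bsub>ring_on A\<^esub> S) (ring_on A)"
  using ring.genideal_ideal[OF cring.axioms(1)[OF cring]] by simp

lemma Idl_self: "S \<subseteq> A \<Longrightarrow> s \<in> S \<Longrightarrow> s \<in> Idl\<^bsub>ring_on A\<^esub> S"
  using ring.genideal_self[OF cring.axioms(1)[OF cring], of S] by auto

lemma Idl_minimal: "ideal Q (ring_on A) \<Longrightarrow> S \<subseteq> Q \<Longrightarrow> Idl\<^bsub>ring_on A\<^esub> S \<subseteq> Q"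
  using ring.genideal_minimal[OF cring.axioms(1)[OF cring]] by blast

text \<open>The elements of \<open>A\<close> with property \<open>P\<close> form an ideal containing
  \<open>S\<close>, so they contain the ideal generated by \<open>S\<close>.\<close>

lemma Idl_induct [consumes 2, case_names base zero add mult]:
  assumes "x \<in> Idl\<^bsub>ring_on A\<^esub> S" "S \<subseteq> A"
    and base: "\<And>s. s \<in> S \<Longrightarrow> P s"
    and zero: "P 0"
    and add: "\<And>x y. x \<in> A \<Longrightarrow> y \<in> A \<Longrightarrow> P x \<Longrightarrow> P y \<Longrightarrow> P (x + y)"
    and mult: "\<And>a x. a \<in> A \<Longrightarrow> x \<in> A \<Longrightarrow> P x \<Longrightarrow> P (a * x)"
  shows "P x"
proof -
  have "ideal {x \<in> A. P x} (ring_on A)"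
    by (rule idealI_on) (use zero add mult in \<open>auto intro: zero_in add_in mult_in\<close>)
  then have "Idl\<^bsub>ring_on A\<^esub> S \<subseteq> {x \<in> A. P x}"
    by (rule Idl_minimal) (use assms(2) base in auto)
  then show ?thesis using assms(1) by auto
qed

lemma Idl_linear_combination:
  assumes "x \<in> Idl\<^bsub>ring_on A\<^esub> (f ` V)" "finite V" "\<And>i. i \<in> V \<Longrightarrow> f i \<in> A"
  shows "\<exists>c. (\<forall>i\<in>V. c i \<in> A) \<and> x = (\<Sum>i\<in>V. c i * f i)"
proof -
  have sub: "f ` V \<subseteq> A" using assms(3) by auto
  from assms(1) sub show ?thesis
  proof (induction rule: Idl_induct)
    case (base s)
    then obtain i where i: "i \<in> V" "s = f i" by auto
    \<comment> \<open>The coefficient family is the indicator of one chosen preimage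
      \<open>i\<close> of \<open>s\<close>, so \<open>f\<close> may take the same value at several
      indices.\<close>
    have "(\<Sum>j\<in>V. (if j = i then 1 else 0) * f j) = (\<Sum>j\<in>V. if j = i then f j else 0)"
      by (rule sum.cong) auto
    also have "\<dots> = s" using i assms(2) by simp
    finally show ?case
      by (intro exI[of _ "\<lambda>j. if j = i then 1 else 0"]) (auto intro: zero_in one_in)
  next
    case zero
    then show ?case by (intro exI[of _ "\<lambda>_. 0"]) (auto intro: zero_in)
  next
    case (add x y)
    then obtain c d where "\<forall>i\<in>V. c i \<in> A" "x = (\<Sum>i\<in>V. c i * f i)"
      "\<forall>i\<in>V. d i \<in> A" "y = (\<Sum>i\<in>V. d i * f i)" by blast
    then show ?case
      by (intro exI[of _ "\<lambda>i. c i + d i"]) (auto intro: add_in simp: sum.distrib distrib_right)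
  next
    case (mult a x)
    then obtain c where "\<forall>i\<in>V. c i \<in> A" "x = (\<Sum>i\<in>V. c i * f i)" by blast
    then show ?case
      using mult(1)
      by (intro exI[of _ "\<lambda>i. a * c i"]) (auto intro: mult_in simp: sum_distrib_left mult.assoc)
  qed
qed

lemma ideal_cong_mult:
  assumes "ideal Q (ring_on A)" "x - x' \<in> Q" "y - y' \<in> Q" "x' \<in> A" "y \<in> A"
  shows "x * y - x' * y' \<in> Q"
proof -
  have "x * y - x' * y' = y * (x - x') + x' * (y - y')" by (simp add: algebra_simps)
  then show ?thesis using assms by (auto intro!: ideal_add ideal_mult)
qed

lemma ideal_cong_power:
  assumes "ideal Q (ring_on A)" "x - y \<in> Q" "x \<in> A" "y \<in> A"
  shows "x ^ k - y ^ k \<in> Q"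
  using assms by (induction k) (auto intro!: ideal_cong_mult power_in ideal_zero)

lemma ideal_cong_prod:
  assumes "ideal Q (ring_on A)" "\<And>i. i \<in> S \<Longrightarrow> g i - h i \<in> Q"
    "\<And>i. i \<in> S \<Longrightarrow> g i \<in> A" "\<And>i. i \<in> S \<Longrightarrow> h i \<in> A"
  shows "prod g S - prod h S \<in> Q"
  using assms(2-4)
proof (induction S rule: infinite_finite_induct)
  case (insert i S)
  then show ?case by (auto intro!: ideal_cong_mult[OF assms(1)] prod_in)
qed (auto intro: ideal_zero[OF assms(1)])

end

section \<open>Polynomials over a subring\<close>

lemma sum_single_keys:
  "(\<Sum>\<alpha>\<in>Poly_Mapping.keys p. Poly_Mapping.single \<alpha> (Poly_Mapping.lookup p \<alpha>)) = p"
  by (rule poly_mapping_eqI) (simp add: lookup_sum lookup_single when_def in_keys_iff)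

lemma mult_sum_single:
  "p * q = (\<Sum>\<alpha>\<in>Poly_Mapping.keys p. \<Sum>\<beta>\<in>Poly_Mapping.keys q.
    Poly_Mapping.single (\<alpha> + \<beta>) (Poly_Mapping.lookup p \<alpha> * Poly_Mapping.lookup q \<beta>))"
  for p q :: "('i, 'a::comm_ring_1) mpoly"
  by (subst (1 2) sum_single_keys[symmetric]) (simp add: sum_product mult_single)

lemma mpolys_single:
  "Poly_Mapping.keys \<alpha> \<subseteq> V \<Longrightarrow> c \<in> A \<Longrightarrow> Poly_Mapping.single \<alpha> c \<in> mpolys V A"
  by (auto simp: mpolys_def)

lemma keys_add_nat:
  fixes \<alpha> \<beta> :: "'i \<Rightarrow>\<^sub>0 nat"
  shows "Poly_Mapping.keys (\<alpha> + \<beta>) = Poly_Mapping.keys \<alpha> \<union> Poly_Mapping.keys \<beta>"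
  by (auto simp: in_keys_iff lookup_add)

context subring_on
begin

lemma mpolys_lookup: "p \<in> mpolys V A \<Longrightarrow> Poly_Mapping.lookup p \<alpha> \<in> A"
  by (cases "\<alpha> \<in> Poly_Mapping.keys p") (auto simp: mpolys_def in_keys_iff intro: zero_in)

lemma mpolys_zero: "0 \<in> mpolys V A"
  by (simp add: mpolys_def)

lemma mpolys_add: "p \<in> mpolys V A \<Longrightarrow> q \<in> mpolys V A \<Longrightarrow> p + q \<in> mpolys V A"
  using keys_add[of p q] mpolys_lookup
  by (auto simp: mpolys_def lookup_add intro!: add_in) blast

lemma mpolys_sum: "(\<And>i. i \<in> S \<Longrightarrow> g i \<in> mpolys V A) \<Longrightarrow> sum g S \<in> mpolys V A"
  by (induction S rule: infinite_finite_induct) (auto intro: mpolys_add mpolys_zero)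

lemma mpolys_mult:
  assumes "p \<in> mpolys V A" "q \<in> mpolys V A"
  shows "p * q \<in> mpolys V A"
proof -
  have "p * q = (\<Sum>\<alpha>\<in>Poly_Mapping.keys p. \<Sum>\<beta>\<in>Poly_Mapping.keys q.
      Poly_Mapping.single (\<alpha> + \<beta>) (Poly_Mapping.lookup p \<alpha> * Poly_Mapping.lookup q \<beta>))"
    by (rule mult_sum_single)
  also have "\<dots> \<in> mpolys V A"
    using assms
    by (intro mpolys_sum mpolys_single mult_in mpolys_lookup) (auto simp: keys_add_nat mpolys_def)
  finally show ?thesis .
qed

lemma subring_mpolys:
  fixes V :: "'i set"
  shows "subring_on (mpolys V A)"
proof
  show "- p \<in> mpolys V A" if "p \<in> mpolys V A" for p :: "('i, 'a) mpoly"
    using that uminus_in by (auto simp: mpolys_def in_keys_iff)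
  show "(1 :: ('i, 'a) mpoly) \<in> mpolys V A"
    using mpolys_single[of 0 V 1 A] one_in by simp
qed (auto intro: mpolys_add mpolys_mult mpolys_zero)

lemma const_in: "c \<in> A \<Longrightarrow> const c \<in> mpolys V A"
  by (auto simp: const_def intro: mpolys_single)

lemma var_in: "i \<in> V \<Longrightarrow> var i \<in> mpolys V A"
  by (auto simp: var_def intro!: mpolys_single one_in)

end

lemma const_add: "const (a + b) = const a + const b"
  and const_mult: "const (a * b) = const a * const b"
  and const_zero: "const 0 = 0"
  and const_one: "const 1 = 1"
  and const_diff: "const (a - b) = const a - const b"
  by (simp_all add: const_def single_add mult_single single_diff)

lemma const_sum: "const (sum g S) = (\<Sum>i\<in>S. const (g i))"
  by (induction S rule: infinite_finite_induct) (auto simp: const_add const_zero)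

section \<open>Evaluation homomorphisms\<close>

definition monom_eval :: "('i \<Rightarrow> 'b::comm_ring_1) \<Rightarrow> ('i \<Rightarrow>\<^sub>0 nat) \<Rightarrow> 'b" where
  "monom_eval g \<alpha> = (\<Prod>j\<in>Poly_Mapping.keys \<alpha>. g j ^ Poly_Mapping.lookup \<alpha> j)"

lemma monom_eval_superset:
  assumes "finite S" "Poly_Mapping.keys \<alpha> \<subseteq> S"
  shows "monom_eval g \<alpha> = (\<Prod>j\<in>S. g j ^ Poly_Mapping.lookup \<alpha> j)"
  unfolding monom_eval_def using assms by (intro prod.mono_neutral_left) (auto simp: in_keys_iff)

lemma monom_eval_add: "monom_eval g (\<alpha> + \<beta>) = monom_eval g \<alpha> * monom_eval g \<beta>"
proof -
  let ?S = "Poly_Mapping.keys \<alpha> \<union> Poly_Mapping.keys \<beta>"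
  have "monom_eval g \<gamma> = (\<Prod>j\<in>?S. g j ^ Poly_Mapping.lookup \<gamma> j)" if "\<gamma> \<in> {\<alpha>, \<beta>, \<alpha> + \<beta>}" for \<gamma>
    using that by (intro monom_eval_superset) (auto simp: keys_add_nat)
  then show ?thesis by (simp add: lookup_add power_add prod.distrib)
qed

lemma monom_eval_zero [simp]: "monom_eval g 0 = 1"
  by (simp add: monom_eval_def)

lemma monom_eval_single [simp]: "monom_eval g (Poly_Mapping.single i k) = g i ^ k"
  by (simp add: monom_eval_def)

lemma monom_eval_var: "monom_eval var \<alpha> = Poly_Mapping.single \<alpha> (1::'a::comm_ring_1)"
proof (induction \<alpha> rule: update_induct)
  case const
  then show ?case by simp
next
  case (update f a b)
  have eq: "Poly_Mapping.update a b f = f + Poly_Mapping.single a b"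
    using update(1) by (intro poly_mapping_eqI) (auto simp: lookup_update lookup_add lookup_single in_keys_iff)
  have "var a ^ b = Poly_Mapping.single (Poly_Mapping.single a b) (1::'a)"
    by (induction b) (auto simp: var_def mult_single single_add[symmetric] )
  then show ?case using update by (simp add: eq monom_eval_add mult_single)
qed

text \<open>The map given by the universal property of a polynomial ring. With \<open>h\<close> the
  constants in \<open>t\<close> it is the Rees map; with \<open>h = const\<close> it is a
  substitution of polynomials for the variables, used to change generators.\<close>

definition subst :: "('a::comm_ring_1 \<Rightarrow> 'b::comm_ring_1) \<Rightarrow> ('i \<Rightarrow> 'b) \<Rightarrow> ('i, 'a) mpoly \<Rightarrow> 'b" where
  "subst h g F = (\<Sum>\<alpha>\<in>Poly_Mapping.keys F. h (Poly_Mapping.lookup F \<alpha>) * monom_eval g \<alpha>)"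

locale ring_hom_on_type =
  fixes h :: "'a::comm_ring_1 \<Rightarrow> 'b::comm_ring_1"
  assumes hom_add: "h (x + y) = h x + h y"
    and hom_mult: "h (x * y) = h x * h y"
    and hom_one: "h 1 = 1"
begin

lemma hom_zero: "h 0 = 0"
  using hom_add[of 0 0] by simp

lemma hom_diff: "h (x - y) = h x - h y"
  using hom_add[of "x - y" y] by (simp add: eq_diff_eq)

lemma hom_sum: "h (sum g S) = (\<Sum>i\<in>S. h (g i))"
  by (induction S rule: infinite_finite_induct) (auto simp: hom_add hom_zero)

lemma hom_prod: "h (prod g S) = (\<Prod>i\<in>S. h (g i))"
  by (induction S rule: infinite_finite_induct) (auto simp: hom_mult hom_one)

lemma hom_power: "h (x ^ k) = h x ^ k"
  by (induction k) (auto simp: hom_mult hom_one)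

lemma hom_monom_eval: "h (monom_eval g \<alpha>) = monom_eval (\<lambda>j. h (g j)) \<alpha>"
  by (simp add: monom_eval_def hom_prod hom_power)

lemma subst_superset:
  assumes "finite S" "Poly_Mapping.keys F \<subseteq> S"
  shows "subst h g F = (\<Sum>\<alpha>\<in>S. h (Poly_Mapping.lookup F \<alpha>) * monom_eval g \<alpha>)"
  unfolding subst_def using assms by (intro sum.mono_neutral_left) (auto simp: in_keys_iff hom_zero)

lemma subst_add: "subst h g (F + G) = subst h g F + subst h g G"
proof -
  let ?S = "Poly_Mapping.keys F \<union> Poly_Mapping.keys G"
  have "subst h g H = (\<Sum>\<alpha>\<in>?S. h (Poly_Mapping.lookup H \<alpha>) * monom_eval g \<alpha>)"
    if "H \<in> {F, G, F + G}" for H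
    using that keys_add[of F G] by (intro subst_superset) auto
  then show ?thesis by (simp add: lookup_add hom_add sum.distrib distrib_right)
qed

lemma subst_single: "subst h g (Poly_Mapping.single \<alpha> c) = h c * monom_eval g \<alpha>"
  by (subst subst_superset[of "{\<alpha>}"]) auto

lemma subst_sum: "subst h g (sum F S) = (\<Sum>i\<in>S. subst h g (F i))"
proof (induction S rule: infinite_finite_induct)
  case (insert x S)
  then show ?case by (simp add: subst_add)
qed (simp_all add: subst_def)

lemma subst_mult: "subst h g (F * G) = subst h g F * subst h g G"
proof -
  have "subst h g (F * G) = (\<Sum>\<alpha>\<in>Poly_Mapping.keys F. \<Sum>\<beta>\<in>Poly_Mapping.keys G.
      (h (Poly_Mapping.lookup F \<alpha>) * monom_eval g \<alpha>) * (h (Poly_Mapping.lookup G \<beta>) * monom_eval g \<beta>))"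
    unfolding mult_sum_single[of F G]
    by (simp add: subst_sum subst_single hom_mult monom_eval_add mult_ac)
  then show ?thesis by (simp add: subst_def sum_product)
qed

lemma subst_hom: "ring_hom_on_type (subst h g)"
  by unfold_locales
    (simp_all add: subst_add subst_mult subst_single hom_one single_one[symmetric] del: single_one)

lemma subst_const: "subst h g (const c) = h c"
  by (simp add: const_def subst_single)

lemma subst_var: "subst h g (var i) = g i"
  by (simp add: var_def subst_single hom_one)

lemma hom_subst: "h (subst k g F) = subst (\<lambda>c. h (k c)) (\<lambda>j. h (g j)) F"
  by (simp add: subst_def hom_sum hom_mult hom_monom_eval)

end

lemma subst_cong:
  assumes "F \<in> mpolys V A" "\<And>j. j \<in> V \<Longrightarrow> g j = g' j"
  shows "subst h g F = subst h g' F"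
proof -
  have "monom_eval g \<alpha> = monom_eval g' \<alpha>" if "\<alpha> \<in> Poly_Mapping.keys F" for \<alpha>
  proof -
    have "Poly_Mapping.keys \<alpha> \<subseteq> V" using that assms(1) by (auto simp: mpolys_def)
    then show ?thesis
      unfolding monom_eval_def using assms(2) by (intro prod.cong) auto
  qed
  then show ?thesis by (simp add: subst_def)
qed

interpretation const: ring_hom_on_type const
  by unfold_locales (simp_all add: const_add const_mult const_one)

interpretation pCons: ring_hom_on_type "\<lambda>a. [:a:]"
  by unfold_locales (simp_all add: one_pCons)

lemma subst_const_var: "subst const var F = F"
  by (subst (3) sum_single_keys[symmetric])
    (simp add: subst_def const_def monom_eval_var mult_single)

context subring_on
begin

lemma subst_in:
  fixes g :: "'i \<Rightarrow> ('j, 'a) mpoly"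
  assumes F: "F \<in> mpolys V A" and g: "\<And>j. j \<in> V \<Longrightarrow> g j \<in> mpolys W A"
  shows "subst const g F \<in> mpolys W A"
proof -
  interpret T: subring_on "mpolys W A :: ('j, 'a) mpoly set" by (rule subring_mpolys)
  show ?thesis
    unfolding subst_def monom_eval_def
    using F by (intro T.sum_in T.mult_in T.prod_in T.power_in const_in mpolys_lookup[OF F] g)
      (auto simp: mpolys_def)
qed

text \<open>\<open>F\<close> is its own value at the variables, and congruence modulo
  \<open>Q\<close> passes through powers, products and linear combinations.\<close>

lemma subst_cong_ideal:
  fixes g :: "'i \<Rightarrow> ('i, 'a) mpoly"
  assumes F: "F \<in> mpolys V A" and g: "\<And>j. j \<in> V \<Longrightarrow> g j \<in> mpolys V A"
    and Q: "ideal Q (ring_on (mpolys V A))" and "\<And>j. j \<in> V \<Longrightarrow> g j - var j \<in> Q"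
  shows "subst const g F - F \<in> Q"
proof -
  interpret T: subring_on "mpolys V A :: ('i, 'a) mpoly set" by (rule subring_mpolys)
  have "subst const g F - F = subst const g F - subst const var F"
    by (simp add: subst_const_var)
  also have "\<dots> = (\<Sum>\<alpha>\<in>Poly_Mapping.keys F.
      const (Poly_Mapping.lookup F \<alpha>) * (monom_eval g \<alpha> - monom_eval var \<alpha>))"
    by (simp add: subst_def sum_subtractf right_diff_distrib)
  also have "\<dots> \<in> Q"
    unfolding monom_eval_def
  proof (intro T.ideal_sum[OF Q] T.ideal_mult[OF Q] T.ideal_cong_prod[OF Q] T.ideal_cong_power[OF Q])
    fix \<alpha> j assume "\<alpha> \<in> Poly_Mapping.keys F" "j \<in> Poly_Mapping.keys \<alpha>"
    then have "j \<in> V" using F by (auto simp: mpolys_def)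
    then show "g j - var j \<in> Q" "g j \<in> mpolys V A" "var j \<in> mpolys V A"
      "g j ^ Poly_Mapping.lookup \<alpha> j \<in> mpolys V A" "var j ^ Poly_Mapping.lookup \<alpha> j \<in> mpolys V A"
      using assms by (auto intro: T.power_in var_in)
  qed (use F in \<open>auto intro: const_in mpolys_lookup\<close>)
  finally show ?thesis .
qed

end

section \<open>Independence of the conductor from the generators\<close>

text \<open>The ideal \<open>J\<close>, with generators indexed by an arbitrary set so that each
  edge can name its own variable.\<close>

definition rees_relations :: "'a::comm_ring_1 set \<Rightarrow> 'i set \<Rightarrow> ('i \<Rightarrow> 'a) \<Rightarrow> ('i, 'a) mpoly set" where
  "rees_relations A V f = {F \<in> mpolys V A. subst (\<lambda>a. [:a:]) (\<lambda>j. monom (f j) (Suc 0)) F = 0}"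

definition linear_forms :: "'a::comm_ring_1 set \<Rightarrow> 'i set \<Rightarrow> ('i \<Rightarrow> 'a) \<Rightarrow> ('i, 'a) mpoly set" where
  "linear_forms A V f =
     {(\<Sum>i\<in>V. const (a i) * var i) | a. (\<forall>i\<in>V. a i \<in> A) \<and> (\<Sum>i\<in>V. a i * f i) = 0}"

definition lin_ideal :: "'a::comm_ring_1 set \<Rightarrow> 'i set \<Rightarrow> ('i \<Rightarrow> 'a) \<Rightarrow> ('i, 'a) mpoly set" where
  "lin_ideal A V f = Idl\<^bsub>ring_on (mpolys V A)\<^esub> (linear_forms A V f)"

definition conductor_on :: "'a::comm_ring_1 set \<Rightarrow> 'i set \<Rightarrow> ('i \<Rightarrow> 'a) \<Rightarrow> 'a set" where
  "conductor_on A V f = {r \<in> A. \<forall>F\<in>rees_relations A V f. const r * F \<in> lin_ideal A V f}"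

text \<open>The kernel of the Rees map is the same whether its values are taken in the Rees algebra
  or among all polynomials in \<open>t\<close>.\<close>

lemma conductor_eq_conductor_on: "conductor A m f = conductor_on A {1..m} f"
proof -
  have "rees_hom f = subst (\<lambda>a. [:a:]) (\<lambda>j. monom (f j) (Suc 0))"
    by (rule ext) (simp add: rees_hom_def subst_def monom_eval_def)
  then show ?thesis
    by (simp add: conductor_def conductor_on_def rees_kernel_def rees_relations_def a_kernel_def'
        linear_relations_def lin_ideal_def linear_forms_def)
qed

context subring_on
begin

section \<open>Linear forms and the change of generators\<close>

lemma linear_formI:
  "(\<And>i. i \<in> V \<Longrightarrow> a i \<in> A) \<Longrightarrow> (\<Sum>i\<in>V. a i * f i) = 0 \<Longrightarrow>
    (\<Sum>i\<in>V. const (a i) * var i) \<in> linear_forms A V f"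
  by (auto simp: linear_forms_def)

lemma linear_form_in:
  fixes V :: "'i set"
  assumes "\<And>i. i \<in> V \<Longrightarrow> a i \<in> A"
  shows "(\<Sum>i\<in>V. const (a i) * var i) \<in> mpolys V A"
proof -
  interpret T: subring_on "mpolys V A :: ('i, 'a) mpoly set" by (rule subring_mpolys)
  show ?thesis using assms by (auto intro!: T.sum_in T.mult_in const_in var_in)
qed

lemma linear_forms_subset: "linear_forms A V f \<subseteq> mpolys V A"
  by (auto simp: linear_forms_def intro: linear_form_in)

lemma ideal_lin_ideal: "ideal (lin_ideal A V f) (ring_on (mpolys V A))"
  unfolding lin_ideal_def by (rule subring_on.ideal_Idl[OF subring_mpolys linear_forms_subset])

lemma lin_ideal_self: "F \<in> linear_forms A V f \<Longrightarrow> F \<in> lin_ideal A V f"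
  unfolding lin_ideal_def by (rule subring_on.Idl_self[OF subring_mpolys linear_forms_subset])

text \<open>Expressing each family through the other gives substitutions \<open>s\<close> and
  \<open>t\<close>. Here \<open>s\<close> carries the Rees relations of \<open>f\<close> to those of
  \<open>g\<close>, \<open>t\<close> carries the linear ideal of \<open>g\<close> into that of
  \<open>f\<close>, and \<open>t\<close> after \<open>s\<close> is the identity modulo the latter.
  Hence for a Rees relation \<open>F\<close> of \<open>f\<close> the product of \<open>r\<close>
  with \<open>F\<close> is congruent to the image under \<open>t\<close> of \<open>r\<close> times
  \<open>s\<close> of \<open>F\<close>, which lies in the linear ideal of \<open>f\<close>.\<close>

lemma conductor_on_subset:
  fixes f :: "'i \<Rightarrow> 'a" and g :: "'j \<Rightarrow> 'a"
  assumes fin: "finite V" "finite W"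
    and f: "\<And>i. i \<in> V \<Longrightarrow> f i \<in> Idl\<^bsub>ring_on A\<^esub> (g ` W)" "\<And>i. i \<in> V \<Longrightarrow> f i \<in> A"
    and g: "\<And>j. j \<in> W \<Longrightarrow> g j \<in> Idl\<^bsub>ring_on A\<^esub> (f ` V)" "\<And>j. j \<in> W \<Longrightarrow> g j \<in> A"
  shows "conductor_on A W g \<subseteq> conductor_on A V f"
proof
  fix r assume r: "r \<in> conductor_on A W g"
  interpret TV: subring_on "mpolys V A :: ('i, 'a) mpoly set" by (rule subring_mpolys)
  interpret TW: subring_on "mpolys W A :: ('j, 'a) mpoly set" by (rule subring_mpolys)
  have "\<exists>c. (\<forall>j\<in>W. c j \<in> A) \<and> f i = (\<Sum>j\<in>W. c j * g j)" if "i \<in> V" for i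
    using Idl_linear_combination[OF f(1)[OF that] fin(2) g(2)] .
  then obtain c where c: "\<And>i j. i \<in> V \<Longrightarrow> j \<in> W \<Longrightarrow> c i j \<in> A"
    "\<And>i. i \<in> V \<Longrightarrow> f i = (\<Sum>j\<in>W. c i j * g j)" by metis
  have "\<exists>d. (\<forall>i\<in>V. d i \<in> A) \<and> g j = (\<Sum>i\<in>V. d i * f i)" if "j \<in> W" for j
    using Idl_linear_combination[OF g(1)[OF that] fin(1) f(2)] .
  then obtain d where d: "\<And>i j. i \<in> V \<Longrightarrow> j \<in> W \<Longrightarrow> d j i \<in> A"
    "\<And>j. j \<in> W \<Longrightarrow> g j = (\<Sum>i\<in>V. d j i * f i)" by metis
  define s where "s i = (\<Sum>j\<in>W. const (c i j) * var j :: ('j, 'a) mpoly)" for i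
  define t where "t j = (\<Sum>i\<in>V. const (d j i) * var i :: ('i, 'a) mpoly)" for j
  interpret S: ring_hom_on_type "subst const s" by (rule const.subst_hom)
  interpret T: ring_hom_on_type "subst const t" by (rule const.subst_hom)
  interpret H: ring_hom_on_type "subst (\<lambda>a. [:a:]) (\<lambda>j. monom (g j) (Suc 0))" by (rule pCons.subst_hom)
  have s_in: "s i \<in> mpolys W A" if "i \<in> V" for i
    unfolding s_def using c(1)[OF that] by (intro linear_form_in)
  have t_in: "t j \<in> mpolys V A" if "j \<in> W" for j
    unfolding t_def using d(1) that by (intro linear_form_in)
  have monom_sum1: "(\<Sum>j\<in>W. monom (u j) (Suc 0)) = monom (sum u W) (Suc 0)" for u :: "'j \<Rightarrow> 'a"
    by (induction W rule: infinite_finite_induct) (auto simp: add_monom)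
  have rees: "subst const s F \<in> rees_relations A W g" if F: "F \<in> rees_relations A V f" for F
  proof -
    have FV: "F \<in> mpolys V A" using F by (simp add: rees_relations_def)
    have "subst (\<lambda>a. [:a:]) (\<lambda>j. monom (g j) (Suc 0)) (s i) = monom (f i) (Suc 0)" if "i \<in> V" for i
      using c(2)[OF that]
      by (simp add: s_def H.hom_sum H.hom_mult pCons.subst_const pCons.subst_var smult_monom monom_sum1)
    then have "subst (\<lambda>a. [:a:]) (\<lambda>j. monom (g j) (Suc 0)) (subst const s F)
        = subst (\<lambda>a. [:a:]) (\<lambda>j. monom (f j) (Suc 0)) F"
      by (simp add: H.hom_subst pCons.subst_const) (rule subst_cong[OF FV])
    then show ?thesis
      using F subst_in[OF FV s_in] by (simp add: rees_relations_def)
  qed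
  have swap: "(\<Sum>j\<in>W. const (a j) * t j) = (\<Sum>i\<in>V. const (\<Sum>j\<in>W. a j * d j i) * var i)" for a
  proof -
    have "(\<Sum>j\<in>W. const (a j) * t j) = (\<Sum>j\<in>W. \<Sum>i\<in>V. const (a j * d j i) * var i)"
      by (simp add: t_def sum_distrib_left const_mult mult.assoc)
    also have "\<dots> = (\<Sum>i\<in>V. \<Sum>j\<in>W. const (a j * d j i) * var i)" by (rule sum.swap)
    finally show ?thesis by (simp add: const_sum sum_distrib_right)
  qed
  have swap': "(\<Sum>i\<in>V. (\<Sum>j\<in>W. a j * d j i) * f i) = (\<Sum>j\<in>W. a j * g j)" for a
  proof -
    have "(\<Sum>j\<in>W. a j * g j) = (\<Sum>j\<in>W. \<Sum>i\<in>V. a j * d j i * f i)"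
      by (simp add: d(2) sum_distrib_left mult.assoc)
    also have "\<dots> = (\<Sum>i\<in>V. \<Sum>j\<in>W. a j * d j i * f i)" by (rule sum.swap)
    finally show ?thesis by (simp add: sum_distrib_right)
  qed
  have lin: "subst const t F \<in> lin_ideal A V f" if "F \<in> lin_ideal A W g" for F
    using that[unfolded lin_ideal_def] linear_forms_subset
  proof (induction rule: TW.Idl_induct)
    case (base l)
    then obtain a where a: "l = (\<Sum>i\<in>W. const (a i) * var i)" "\<And>i. i \<in> W \<Longrightarrow> a i \<in> A"
      "(\<Sum>i\<in>W. a i * g i) = 0" by (auto simp: linear_forms_def)
    have "subst const t l = (\<Sum>j\<in>W. const (a j) * t j)"
      by (simp add: a(1) T.hom_sum T.hom_mult const.subst_const const.subst_var)
    moreover have "\<dots> \<in> lin_ideal A V f"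
      unfolding swap using a d(1)
      by (intro lin_ideal_self linear_formI) (auto intro!: sum_in mult_in simp: swap')
    ultimately show ?case by simp
  next
    case zero
    then show ?case by (simp add: T.hom_zero TV.ideal_zero[OF ideal_lin_ideal])
  next
    case (add x y)
    then show ?case by (simp add: T.hom_add TV.ideal_add[OF ideal_lin_ideal])
  next
    case (mult a x)
    then show ?case by (simp add: T.hom_mult TV.ideal_mult[OF ideal_lin_ideal] subst_in[OF mult(1) t_in])
  qed
  have rA: "r \<in> A" using r by (simp add: conductor_on_def)
  have ts: "subst const t (subst const s F) - F \<in> lin_ideal A V f" if F: "F \<in> mpolys V A" for F
  proof -
    have "subst const t (subst const s F) = subst const (\<lambda>i. subst const t (s i)) F"
      by (simp add: T.hom_subst const.subst_const)
    moreover have "subst const (\<lambda>i. subst const t (s i)) F - F \<in> lin_ideal A V f"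
    proof (rule subst_cong_ideal[OF F _ ideal_lin_ideal])
      fix i assume i: "i \<in> V"
      show "subst const t (s i) \<in> mpolys V A"
        using s_in[OF i] t_in by (rule subst_in)
      have "subst const t (s i) - var i = (\<Sum>j\<in>W. const (c i j) * t j) - var i"
        by (simp add: s_def T.hom_sum T.hom_mult const.subst_const const.subst_var)
      also have "\<dots> = (\<Sum>k\<in>V. const (\<Sum>j\<in>W. c i j * d j k) * var k)
          - (\<Sum>k\<in>V. if k = i then var k else 0)"
        using i fin by (simp add: swap)
      also have "\<dots> = (\<Sum>k\<in>V. const ((\<Sum>j\<in>W. c i j * d j k) - (if k = i then 1 else 0)) * var k)"
        unfolding sum_subtractf[symmetric]
        by (intro sum.cong) (auto simp: const_diff left_diff_distrib const_one const_zero)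
      \<comment> \<open>Evaluated at \<open>f\<close>, the linear form gives
        \<open>f i - f i\<close>: going through the \<open>g j\<close> and back expresses
        \<open>f i\<close> by the \<open>f k\<close> once more, and the indicator subtracts
        \<open>f i\<close> itself.\<close>
      also have "\<dots> \<in> lin_ideal A V f"
      proof (intro lin_ideal_self linear_formI)
        show "(\<Sum>j\<in>W. c i j * d j k) - (if k = i then 1 else 0) \<in> A" if "k \<in> V" for k
          using c(1) d(1) i that by (auto intro!: diff_in sum_in mult_in one_in zero_in)
        have "(\<Sum>k\<in>V. (if k = i then 1 else 0) * f k) = (\<Sum>k\<in>V. if k = i then f k else 0)"
          by (rule sum.cong) auto
        then show "(\<Sum>k\<in>V. ((\<Sum>j\<in>W. c i j * d j k) - (if k = i then 1 else 0)) * f k) = 0"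
          using i fin by (simp add: left_diff_distrib sum_subtractf swap' c(2)[OF i])
      qed
      finally show "subst const t (s i) - var i \<in> lin_ideal A V f" .
    qed
    ultimately show ?thesis by simp
  qed
  have "const r * F \<in> lin_ideal A V f" if F: "F \<in> rees_relations A V f" for F
  proof -
    let ?F = "subst const t (subst const s F)"
    have "const r * subst const s F \<in> lin_ideal A W g"
      using r rees[OF F] by (auto simp: conductor_on_def)
    from lin[OF this] have 1: "const r * ?F \<in> lin_ideal A V f"
      by (simp add: T.hom_mult const.subst_const)
    have 2: "const r * (?F - F) \<in> lin_ideal A V f"
      using F by (intro TV.ideal_mult[OF ideal_lin_ideal] ts const_in rA) (simp add: rees_relations_def)
    have "const r * F = const r * ?F - const r * (?F - F)" by (simp add: algebra_simps)
    then show ?thesis using TV.ideal_diff[OF ideal_lin_ideal 1 2] by simp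
  qed
  then show "r \<in> conductor_on A V f" using rA by (simp add: conductor_on_def)
qed

end

section \<open>Monomials as multisets\<close>

text \<open>A bijection from finite multisets to exponent vectors. It turns products of monomials
  into multiset sums and divisibility into multiset inclusion.\<close>

definition expo :: "'i multiset \<Rightarrow> 'i \<Rightarrow>\<^sub>0 nat" where
  "expo M = (\<Sum>i\<in>#M. Poly_Mapping.single i 1)"

lemma expo_empty [simp]: "expo {#} = 0"
  and expo_add: "expo (M + N) = expo M + expo N"
  and expo_add_mset: "expo (add_mset i M) = Poly_Mapping.single i 1 + expo M"
  by (simp_all add: expo_def)

lemma lookup_expo: "Poly_Mapping.lookup (expo M) i = count M i"
  by (induction M) (auto simp: expo_add_mset lookup_add lookup_single when_def)

lemma keys_expo: "Poly_Mapping.keys (expo M) = set_mset M"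
  by (auto simp: in_keys_iff lookup_expo)

lemma expo_inject [simp]: "expo M = expo N \<longleftrightarrow> M = N"
  by (metis lookup_expo multiset_eqI)

lemma expo_surj: obtains M where "\<alpha> = expo M"
proof
  have "finite {i. 0 < Poly_Mapping.lookup \<alpha> i}"
    using finite_keys[of \<alpha>] by (rule rev_finite_subset) (auto simp: in_keys_iff)
  then show "\<alpha> = expo (Abs_multiset (Poly_Mapping.lookup \<alpha>))"
    by (intro poly_mapping_eqI) (simp add: lookup_expo count_Abs_multiset)
qed

lemma expo_eq_add:
  assumes "expo M = expo N + \<beta>"
  shows "N \<subseteq># M"
proof -
  obtain B where "\<beta> = expo B" by (rule expo_surj)
  then show ?thesis using assms by (simp add: expo_add[symmetric])
qed

text \<open>The monomial x^a y^B of the ring in the \<open>y\<close> over the ring in the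
  \<open>x\<close>.\<close>

definition mmon :: "'i multiset \<Rightarrow> 'e multiset \<Rightarrow> ('e, ('i, 'k::comm_ring_1) mpoly) mpoly" where
  "mmon a B = Poly_Mapping.single (expo B) (Poly_Mapping.single (expo a) 1)"

lemma mmon_mult: "mmon a B * mmon c D = mmon (a + c) (B + D)"
  by (simp add: mmon_def mult_single expo_add)

lemma mmon_eq_iff:
  "(mmon a B :: ('e, ('i, 'k::comm_ring_1) mpoly) mpoly) = mmon c D \<longleftrightarrow> a = c \<and> B = D"
proof
  assume eq: "(mmon a B :: ('e, ('i, 'k) mpoly) mpoly) = mmon c D"
  have ne: "Poly_Mapping.single \<alpha> (1::'k) \<noteq> 0" for \<alpha> :: "'i \<Rightarrow>\<^sub>0 nat"
    by (metis lookup_single_eq lookup_zero zero_neq_one)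
  have "B = D" using arg_cong[OF eq, of Poly_Mapping.keys] ne by (simp add: mmon_def)
  moreover have "Poly_Mapping.single (expo a) (1::'k) = Poly_Mapping.single (expo c) 1"
    using arg_cong[OF eq, of "\<lambda>p. Poly_Mapping.lookup p (expo B)"] \<open>B = D\<close> by (simp add: mmon_def)
  from arg_cong[OF this, of Poly_Mapping.keys] have "a = c" by simp
  ultimately show "a = c \<and> B = D" by simp
qed simp

text \<open>The cofactor may be any polynomial, but every exponent of a product is a sum of
  exponents of the factors, and the divisor has the single exponent \<open>expo B\<close>.\<close>

lemma mmon_dvd_imp_subset:
  assumes "(mmon {#} B :: ('e, ('i, 'k::comm_ring_1) mpoly) mpoly) dvd mmon {#} D"
  shows "B \<subseteq># D"
proof -
  obtain X :: "('e, ('i, 'k) mpoly) mpoly" where X: "mmon {#} D = mmon {#} B * X"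
    using assms by (elim dvdE)
  have "expo D \<in> Poly_Mapping.keys (mmon {#} D :: ('e, ('i, 'k) mpoly) mpoly)"
    by (simp add: mmon_def)
  then obtain \<alpha> \<beta> where
    "\<alpha> \<in> Poly_Mapping.keys (mmon {#} B :: ('e, ('i, 'k) mpoly) mpoly)" "expo D = \<alpha> + \<beta>"
    using keys_mult[of "mmon {#} B :: ('e, ('i, 'k) mpoly) mpoly" X] X by auto
  moreover from this(1) have "\<alpha> = expo B" by (simp add: mmon_def)
  ultimately show ?thesis using expo_eq_add by blast
qed

text \<open>End points with multiplicity. For a loop the minimum and the maximum coincide, so its
  vertex counts twice, matching the generator x_i^2.\<close>

definition ends :: "nat set \<Rightarrow> nat multiset" where
  "ends e = {#Min e, Max e#}"

lemma ends_pair [simp]: "ends {i, j} = {#i, j#}"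
  by (cases i j rule: linorder_cases) (auto simp: ends_def)

text \<open>The degree sequence of a multiset of edges, that is, the exponent of the product of its
  edge monomials.\<close>

definition vdeg :: "nat set multiset \<Rightarrow> nat multiset" where
  "vdeg B = (\<Sum>e\<in>#B. ends e)"

lemma vdeg_simps [simp]: "vdeg {#} = {#}" "vdeg (add_mset e B) = ends e + vdeg B"
  "vdeg (B + D) = vdeg B + vdeg D"
  by (simp_all add: vdeg_def)

lemma size_vdeg: "size (vdeg B) = 2 * size B"
  by (induction B) (auto simp: ends_def)

definition gen :: "nat set \<Rightarrow> (nat, 'k::comm_ring_1) mpoly" where
  "gen e = Poly_Mapping.single (expo (ends e)) 1"

lemma gen_pair: "gen {i, j} = var i * var j"
  by (simp add: gen_def var_def mult_single expo_add_mset single_add)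

section \<open>Alternating walks\<close>

text \<open>Entries at even and at odd positions, counted from 0; for a walk these are the exponents
  of h+ and h-. The recursion is mutual because removing the head swaps the parities.\<close>

fun evs ods :: "'a list \<Rightarrow> 'a multiset" where
  "evs [] = {#}"
| "evs (x # xs) = add_mset x (ods xs)"
| "ods [] = {#}"
| "ods (x # xs) = evs xs"

fun walk :: "nat list \<Rightarrow> nat set list" where
  "walk (u # v # xs) = {u, v} # walk (v # xs)"
| "walk xs = []"

lemma length_walk [simp]: "length (walk (u # xs)) = length xs"
  by (induction xs arbitrary: u) auto

lemma nth_walk: "k < length xs \<Longrightarrow> walk (u # xs) ! k = {(u # xs) ! k, xs ! k}"
  by (induction xs arbitrary: u k) (auto simp: nth_Cons split: nat.split)

text \<open>Closing the cyclic vertex list by repeating its first vertex at the end replaces indices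
  modulo the length by a list that can be treated by recursion.\<close>

lemma even_closed_walk_iff:
  "even_closed_walk E \<Gamma> \<longleftrightarrow>
    set \<Gamma> \<subseteq> E \<and> (\<exists>u xs. xs \<noteq> [] \<and> even (length xs) \<and> last xs = u \<and> \<Gamma> = walk (u # xs))"
proof -
  have eq: "map (\<lambda>k. {js ! k, js ! (Suc k mod length js)}) [0..<length js] = walk (u # xs)"
    if "js @ [u] = u # xs" "js \<noteq> []" for js xs and u :: nat
  proof (rule nth_equalityI)
    have len: "length js = length xs" using arg_cong[OF that(1), of length] by simp
    then show "length (map (\<lambda>k. {js ! k, js ! (Suc k mod length js)}) [0..<length js])
      = length (walk (u # xs))" by simp
    fix k assume "k < length (map (\<lambda>k. {js ! k, js ! (Suc k mod length js)}) [0..<length js])"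
    then have k: "k < length js" by simp
    have 1: "(u # xs) ! k = js ! k" using k by (simp add: that(1)[symmetric] nth_append)
    have "(u # xs) ! Suc k = js ! (Suc k mod length js)"
    \<comment> \<open>For the closing edge the index wraps to 0, and the appended last entry
      \<open>u\<close> is indeed \<open>js ! 0\<close>.\<close>
    proof (cases "Suc k = length js")
      case True
      have "js ! 0 = u" using that by (cases js) auto
      then show ?thesis using True by (simp add: that(1)[symmetric] nth_append del: nth_Cons_Suc)
    next
      case False
      then show ?thesis using k by (simp add: that(1)[symmetric] nth_append del: nth_Cons_Suc)
    qed
    then show "map (\<lambda>k. {js ! k, js ! (Suc k mod length js)}) [0..<length js] ! k = walk (u # xs) ! k"
      using k len 1 by (simp add: nth_walk)
  qed
  have "(\<exists>js. js \<noteq> [] \<and> even (length js) \<and>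
        \<Gamma> = map (\<lambda>k. {js ! k, js ! (Suc k mod length js)}) [0..<length js])
     \<longleftrightarrow> (\<exists>u xs. xs \<noteq> [] \<and> even (length xs) \<and> last xs = u \<and> \<Gamma> = walk (u # xs))"
  proof (intro iffI; elim exE conjE)
    fix js assume js: "js \<noteq> []" "even (length js)"
      "\<Gamma> = map (\<lambda>k. {js ! k, js ! (Suc k mod length js)}) [0..<length js]"
    then obtain u ys where "js = u # ys" by (cases js) auto
    then show "\<exists>u xs. xs \<noteq> [] \<and> even (length xs) \<and> last xs = u \<and> \<Gamma> = walk (u # xs)"
      using js eq[of js u "ys @ [u]"] by (intro exI[of _ u] exI[of _ "ys @ [u]"]) auto
  next
    fix u xs assume xs: "xs \<noteq> []" "even (length xs)" "last xs = u" "\<Gamma> = walk (u # xs)"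
    then have "(u # butlast xs) @ [u] = u # xs" by auto
    from eq[OF this] xs show "\<exists>js. js \<noteq> [] \<and> even (length js) \<and>
        \<Gamma> = map (\<lambda>k. {js ! k, js ! (Suc k mod length js)}) [0..<length js]"
      by (intro exI[of _ "u # butlast xs"]) auto
  qed
  then show ?thesis by (simp add: even_closed_walk_def)
qed

text \<open>Induction removes two edges at a time. Even length matters: \<open>walk_plus\<close>
  runs to half the length rounded down and would miss the last entry of a list of odd
  length.\<close>

lemma walk_plus_eq:
  "length \<Gamma> = 2 * q \<Longrightarrow> (walk_plus \<Gamma> :: (nat set, ('i, 'k::comm_ring_1) mpoly) mpoly) = mmon {#} (evs \<Gamma>)"
  and walk_minus_eq:
  "length \<Gamma> = 2 * q \<Longrightarrow> (walk_minus \<Gamma> :: (nat set, ('i, 'k) mpoly) mpoly) = mmon {#} (ods \<Gamma>)"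
proof (induction q arbitrary: \<Gamma>)
  case (Suc q)
  have var: "(var e :: (nat set, ('i, 'k) mpoly) mpoly) = mmon {#} {#e#}" for e
    by (simp add: mmon_def var_def expo_add_mset)
  { case 1
    then obtain e e' \<Delta> where \<Gamma>: "\<Gamma> = e # e' # \<Delta>" "length \<Delta> = 2 * q"
      by (cases \<Gamma>; cases "tl \<Gamma>") auto
    have "(walk_plus \<Gamma> :: (nat set, ('i, 'k) mpoly) mpoly) = var e * walk_plus \<Delta>"
      by (simp add: walk_plus_def \<Gamma> prod.lessThan_Suc_shift del: prod.lessThan_Suc)
    then show ?case using Suc(1)[OF \<Gamma>(2)] by (simp add: \<Gamma> var mmon_mult) }
  { case 2
    then obtain e e' \<Delta> where \<Gamma>: "\<Gamma> = e # e' # \<Delta>" "length \<Delta> = 2 * q"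
      by (cases \<Gamma>; cases "tl \<Gamma>") auto
    have "(walk_minus \<Gamma> :: (nat set, ('i, 'k) mpoly) mpoly) = var e' * walk_minus \<Delta>"
      by (simp add: walk_minus_def \<Gamma> prod.lessThan_Suc_shift del: prod.lessThan_Suc)
    then show ?case using Suc(2)[OF \<Gamma>(2)] by (simp add: \<Gamma> var mmon_mult) }
qed (simp_all add: walk_plus_def walk_minus_def mmon_def single_one)

lemma even_closed_walk_even: "even_closed_walk E \<Gamma> \<Longrightarrow> even (length \<Gamma>)"
  by (auto simp: even_closed_walk_def)

lemma walk_binomial_eq:
  assumes "even_closed_walk E \<Gamma>"
  shows "walk_plus \<Gamma> = mmon {#} (evs \<Gamma>)" "walk_minus \<Gamma> = mmon {#} (ods \<Gamma>)"
    "walk_binomial \<Gamma> = mmon {#} (evs \<Gamma>) - mmon {#} (ods \<Gamma>)"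
  using even_closed_walk_even[OF assms]
  by (auto elim!: evenE simp: walk_binomial_def walk_plus_eq walk_minus_eq)

lemma set_evs_ods: "set_mset (evs xs) \<union> set_mset (ods xs) = set xs"
  by (induction xs) auto

lemma size_evs_ods:
  "size (evs xs) + size (ods xs) = length xs"
  "even (length xs) \<Longrightarrow> size (evs xs) = size (ods xs)"
proof -
  have "size (evs xs) + size (ods xs) = length xs \<and>
    size (evs xs) = size (ods xs) + (if even (length xs) then 0 else 1)"
    by (induction xs) auto
  then show "size (evs xs) + size (ods xs) = length xs"
    "even (length xs) \<Longrightarrow> size (evs xs) = size (ods xs)" by auto
qed

text \<open>Each passage through an inner vertex contributes once at an even and once at an odd
  position, so only the two ends of the walk are unbalanced. The start belongs to the even
  positions, and the parity of the length decides where the last vertex counts.\<close>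

lemma vdeg_walk:
  "if even (length xs)
    then add_mset (last (u # xs)) (vdeg (evs (walk (u # xs)))) = add_mset u (vdeg (ods (walk (u # xs))))
    else vdeg (evs (walk (u # xs))) = {#u, last (u # xs)#} + vdeg (ods (walk (u # xs)))"
proof (induction xs arbitrary: u)
  case (Cons w xs)
  show ?case
    using Cons[of w] by (auto simp: add_mset_commute split: if_splits)
qed simp

lemma vdeg_closed_walk:
  assumes "even_closed_walk E \<Gamma>"
  shows "vdeg (evs \<Gamma>) = vdeg (ods \<Gamma>)"
proof -
  obtain xs where "xs \<noteq> []" "even (length xs)" "\<Gamma> = walk (last xs # xs)"
    using assms by (auto simp: even_closed_walk_iff)
  then show ?thesis using vdeg_walk[of xs "last xs"] by simp
qed

section \<open>Existence of alternating walks in pairs of edge multisets\<close>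

definition is_edges :: "nat set set \<Rightarrow> bool" where
  "is_edges E \<longleftrightarrow> (\<forall>e\<in>E. \<exists>i j. e = {i, j})"

lemma incident_edge:
  assumes "u \<in># vdeg B" "is_edges (set_mset B)"
  obtains w where "{u, w} \<in># B"
proof -
  obtain e where e: "e \<in># B" "u \<in># ends e" using assms(1) by (auto simp: vdeg_def)
  then obtain i j where "e = {i, j}" using assms(2) by (auto simp: is_edges_def)
  with e show thesis by (auto intro: that simp: doubleton_eq_iff) (metis insert_commute that)
qed

lemma is_edges_mono: "is_edges F \<Longrightarrow> E \<subseteq> F \<Longrightarrow> is_edges E"
  by (auto simp: is_edges_def)

lemma vdeg_diff: "e \<in># B \<Longrightarrow> vdeg B = ends e + vdeg (B - {#e#})"
  by (metis vdeg_simps(2) insert_DiffM)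

text \<open>Greedy construction. If \<open>u\<close> differs from \<open>v\<close>, the balance
  forces an edge from \<open>u\<close> to some \<open>w\<close> in \<open>B\<close>; once it is
  removed, the balance forces an edge from \<open>w\<close> to some \<open>z\<close> in
  \<open>D\<close>. Without these two edges the same balance holds with \<open>z\<close> in place of
  \<open>u\<close>, and \<open>B\<close> has shrunk.\<close>

lemma alternating_path:
  assumes "is_edges (set_mset B)" "is_edges (set_mset D)" "add_mset v (vdeg B) = add_mset u (vdeg D)"
  shows "\<exists>xs. even (length xs) \<and> last (u # xs) = v \<and>
    evs (walk (u # xs)) \<subseteq># B \<and> ods (walk (u # xs)) \<subseteq># D"
  using assms
proof (induction "size B" arbitrary: u B D rule: less_induct)
  case less
  show ?case
  proof (cases "u = v")
    case True
    then show ?thesis by (intro exI[of _ "[]"]) auto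
  next
    case False
    then have "u \<in># vdeg B"
      using less.prems(3) by (metis insert_noteq_member)
    then obtain w where w: "{u, w} \<in># B" by (rule incident_edge) (rule less.prems(1))
    have "add_mset v (add_mset w (vdeg (B - {#{u, w}#}))) = vdeg D"
      using less.prems(3) vdeg_diff[OF w] by (simp add: add_mset_commute)
    then have "w \<in># vdeg D" by (metis union_single_eq_member add_mset_commute)
    then obtain z where z: "{w, z} \<in># D" by (rule incident_edge) (rule less.prems(2))
    have "add_mset v (vdeg (B - {#{u, w}#})) = add_mset z (vdeg (D - {#{w, z}#}))"
      using less.prems(3) vdeg_diff[OF w] vdeg_diff[OF z] by (simp add: add_mset_commute)
    moreover have "size (B - {#{u, w}#}) < size B" using w by (rule size_Diff1_less)
    ultimately obtain xs where xs: "even (length xs)" "last (z # xs) = v"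
      "evs (walk (z # xs)) \<subseteq># B - {#{u, w}#}" "ods (walk (z # xs)) \<subseteq># D - {#{w, z}#}"
      using less.hyps[of "B - {#{u, w}#}" "D - {#{w, z}#}" z] less.prems(1,2)
      by (meson in_diffD is_edges_mono subsetI)
    then show ?thesis
      using w z by (intro exI[of _ "w # z # xs"]) (auto simp: insert_subset_eq_iff)
  qed
qed

text \<open>The first two edges, from \<open>u\<close> over \<open>w\<close> to \<open>z\<close>,
  are chosen by hand and an alternating path leads from \<open>z\<close> back to \<open>u\<close>.
  This makes the closed walk non-empty even when that path is empty.\<close>

lemma alternating_closed_walk:
  assumes "is_edges (set_mset B)" "is_edges (set_mset D)" "vdeg B = vdeg D" "B \<noteq> {#}"
    "set_mset B \<subseteq> E" "set_mset D \<subseteq> E"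
  obtains \<Gamma> where "even_closed_walk E \<Gamma>" "evs \<Gamma> \<subseteq># B" "ods \<Gamma> \<subseteq># D"
proof -
  obtain e where "e \<in># B" using assms(4) by blast
  then obtain u w where w: "{u, w} \<in># B" using assms(1) by (auto simp: is_edges_def)
  have "w \<in># vdeg D" using vdeg_diff[OF w] assms(3) by (metis ends_pair union_iff union_single_eq_member add_mset_commute)
  then obtain z where z: "{w, z} \<in># D" by (rule incident_edge) (rule assms(2))
  have "add_mset u (vdeg (B - {#{u, w}#})) = add_mset z (vdeg (D - {#{w, z}#}))"
    using assms(3) vdeg_diff[OF w] vdeg_diff[OF z] by (simp add: add_mset_commute)
  moreover have "is_edges (set_mset (B - {#{u, w}#}))" "is_edges (set_mset (D - {#{w, z}#}))"
    using assms(1,2) by (meson in_diffD is_edges_mono subsetI)+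
  ultimately obtain xs where xs: "even (length xs)" "last (z # xs) = u"
    "evs (walk (z # xs)) \<subseteq># B - {#{u, w}#}" "ods (walk (z # xs)) \<subseteq># D - {#{w, z}#}"
    using alternating_path[of "B - {#{u, w}#}" "D - {#{w, z}#}" u z] by blast
  let ?\<Gamma> = "walk (u # w # z # xs)"
  have sub: "evs ?\<Gamma> \<subseteq># B" "ods ?\<Gamma> \<subseteq># D"
    using xs w z by (auto simp: insert_subset_eq_iff)
  have "set ?\<Gamma> \<subseteq> E"
    unfolding set_evs_ods[symmetric]
    using set_mset_mono[OF sub(1)] set_mset_mono[OF sub(2)] assms(5,6) by blast
  then have "even_closed_walk E ?\<Gamma>"
    unfolding even_closed_walk_iff using xs by (intro conjI exI[of _ u] exI[of _ "w # z # xs"]) auto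
  then show thesis using sub by (rule that)
qed

section \<open>Binomials of the Rees ideal of an edge ideal\<close>

lemma single_sum: "Poly_Mapping.single k (sum f S) = (\<Sum>x\<in>S. Poly_Mapping.single k (f x))"
  by (induction S rule: infinite_finite_induct) (auto simp: single_add)

lemma inj_expo: "inj expo"
  by (rule injI) simp

lemma expo_vimage: "finite (expo -` Poly_Mapping.keys p)"
  "bij_betw expo (expo -` Poly_Mapping.keys p) (Poly_Mapping.keys p)"
proof -
  show "finite (expo -` Poly_Mapping.keys p)" by (intro finite_vimageI inj_expo) simp
  have "\<alpha> \<in> range expo" for \<alpha> :: "'a \<Rightarrow>\<^sub>0 nat" using expo_surj by blast
  then show "bij_betw expo (expo -` Poly_Mapping.keys p) (Poly_Mapping.keys p)"
    using inj_expo by (auto simp: bij_betw_def image_vimage_eq intro: inj_on_subset)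
qed

lemma sum_single_expo:
  "(\<Sum>M\<in>expo -` Poly_Mapping.keys p. Poly_Mapping.single (expo M) (Poly_Mapping.lookup p (expo M))) = p"
  using sum.reindex_bij_betw[OF expo_vimage(2)[of p],
      of "\<lambda>\<alpha>. Poly_Mapping.single \<alpha> (Poly_Mapping.lookup p \<alpha>)"]
  by (simp add: sum_single_keys)

lemma monom_eval_expo: "monom_eval g (expo B) = (\<Prod>e\<in>#B. g e)"
  by (induction B) (simp_all add: expo_add_mset monom_eval_add)

text \<open>The image of the monomial y^B under the Rees map: its \<open>x\<close>-part records the
  degrees of \<open>B\<close>, and the power of \<open>t\<close> its number of edges.\<close>

lemma prod_rees_gen:
  "(\<Prod>e\<in>#B. monom (gen e) (Suc 0)) = monom (Poly_Mapping.single (expo (vdeg B)) (1::'k::comm_ring_1)) (size B)"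
  by (induction B) (simp_all add: gen_def mult_monom mult_single expo_add)

locale edge_graph =
  fixes n :: nat and E :: "nat set set" and A :: "(nat, 'k::field) mpoly set"
  assumes graph: "loop_graph n E" and A_eq: "A = mpolys {1..n} UNIV"
begin

sublocale A: subring_on A
  unfolding A_eq by (rule subring_on.subring_mpolys) (unfold_locales, auto)

sublocale TT: subring_on "mpolys E A :: (nat set, (nat, 'k) mpoly) mpoly set"
  by (rule A.subring_mpolys)

lemma finite_E: "finite E"
proof (rule finite_subset)
  show "E \<subseteq> Pow {1..n}" using graph by (fastforce simp: loop_graph_def)
qed simp

lemma is_edges_E: "is_edges E"
  using graph by (fastforce simp: loop_graph_def is_edges_def)

lemma edge_cases:
  assumes "e \<in> E"
  obtains i j where "e = {i, j}" "i \<in> {1..n}" "j \<in> {1..n}" "ends e = {#i, j#}"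
  using assms graph by (fastforce simp: loop_graph_def)

lemma ends_subset: "e \<in> E \<Longrightarrow> set_mset (ends e) \<subseteq> {1..n}"
  by (elim edge_cases) auto

lemma single_expo_in: "set_mset a \<subseteq> {1..n} \<Longrightarrow> Poly_Mapping.single (expo a) c \<in> A"
  by (simp add: A_eq mpolys_single keys_expo)

lemma gen_in: "e \<in> E \<Longrightarrow> gen e \<in> A"
  unfolding gen_def by (intro single_expo_in ends_subset)

lemma mmon_in: "set_mset a \<subseteq> {1..n} \<Longrightarrow> set_mset B \<subseteq> E \<Longrightarrow> mmon a B \<in> mpolys E A"
  unfolding mmon_def by (intro mpolys_single single_expo_in) (auto simp: keys_expo)

end

text \<open>Computation modulo an ideal \<open>Q\<close> containing the linear relations
  \<open>L\<close>. It is applied twice: with \<open>Q = L\<close>, and with \<open>Q\<close> the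
  ideal of all \<open>F\<close> that a fixed \<open>r\<close> multiplies into
  \<open>L\<close>.\<close>

locale edge_quotient = edge_graph n E A
  for n :: nat and E :: "nat set set" and A :: "(nat, 'k::field) mpoly set" +
  fixes Q :: "(nat set, (nat, 'k) mpoly) mpoly set"
  assumes Q: "ideal Q (ring_on (mpolys E A))"
    and lin: "lin_ideal A E gen \<subseteq> Q"
begin

definition cg :: "(nat set, (nat, 'k) mpoly) mpoly \<Rightarrow> (nat set, (nat, 'k) mpoly) mpoly \<Rightarrow> bool"
  (infix "\<approx>" 50) where
  "x \<approx> y \<longleftrightarrow> x - y \<in> Q"

lemma cg_refl [simp]: "x \<approx> x"
  by (simp add: cg_def TT.ideal_zero[OF Q])

lemma cg_sym: "x \<approx> y \<Longrightarrow> y \<approx> x"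
  using TT.ideal_uminus[OF Q, of "x - y"] by (simp add: cg_def)

lemma cg_trans [trans]: "x \<approx> y \<Longrightarrow> y \<approx> z \<Longrightarrow> x \<approx> z"
  using TT.ideal_add[OF Q, of "x - y" "y - z"] by (simp add: cg_def)

lemma cg_mult: "z \<in> mpolys E A \<Longrightarrow> x \<approx> y \<Longrightarrow> z * x \<approx> z * y"
  using TT.ideal_mult[OF Q, of z "x - y"] by (simp add: cg_def right_diff_distrib)

lemma cg_mmon_add:
  assumes "mmon a B \<approx> mmon c D" "set_mset s \<subseteq> {1..n}" "set_mset F \<subseteq> E"
  shows "mmon (s + a) (F + B) \<approx> mmon (s + c) (F + D)"
  using cg_mult[OF mmon_in[OF assms(2,3)] assms(1)] by (simp add: mmon_mult)

lemma linear_binomial: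
  assumes "e \<in> E" "e' \<in> E" "p \<in> A" "q \<in> A" "p * gen e = q * gen e'"
  shows "const p * var e \<approx> const q * var e'"
proof -
  \<comment> \<open>A difference of two indicators, so that the coefficient is correctly
    \<open>p - q\<close> when \<open>e\<close> and \<open>e'\<close> coincide.\<close>
  define a where "a d = (if d = e then p else 0) - (if d = e' then q else 0)" for d
  have aux: "(\<Sum>d\<in>E. (if d = e then u else 0) * w d) = u * w e"
    if "e \<in> E" for e u and w :: "nat set \<Rightarrow> 'b::comm_ring_1"
  proof -
    have "(\<Sum>d\<in>E. (if d = e then u else 0) * w d) = (\<Sum>d\<in>E. if d = e then u * w d else 0)"
      by (rule sum.cong) auto
    then show ?thesis using that finite_E by simp
  qed
  have const_if: "const (if P then u else 0) = (if P then const u else 0)"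
    for P and u :: "(nat, 'k) mpoly" by (simp add: const_zero)
  have "(\<Sum>d\<in>E. const (a d) * var d) = const p * var e - const q * var e'"
    using assms(1,2) by (simp add: a_def const_diff const_if left_diff_distrib sum_subtractf aux)
  moreover have "(\<Sum>d\<in>E. a d * gen d) = 0"
    using assms(1,2,5) by (simp add: a_def left_diff_distrib sum_subtractf aux)
  then have "(\<Sum>d\<in>E. const (a d) * var d) \<in> lin_ideal A E gen"
    using assms(3,4)
    by (intro A.lin_ideal_self A.linear_formI) (auto simp: a_def intro!: A.diff_in A.zero_in A.uminus_in)
  ultimately show ?thesis using lin by (auto simp: cg_def)
qed

text \<open>The basic exchange: the equation says that the edge monomials of \<open>e\<close> and
  \<open>e'\<close> become equal after multiplication by x^s and x^t, which is a linear relation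
  with two terms.\<close>

lemma move:
  assumes "e \<in> E" "e' \<in> E" "set_mset s \<subseteq> {1..n}" "set_mset t \<subseteq> {1..n}" "set_mset B \<subseteq> E"
    and "s + ends e = t + ends e'"
  shows "mmon s (add_mset e B) \<approx> mmon t (add_mset e' B)"
proof -
  have eq: "const (Poly_Mapping.single (expo u) 1) * var d = mmon u {#d#}"
    for u :: "nat multiset" and d :: "nat set"
    by (simp add: const_def var_def mmon_def mult_single expo_add_mset)
  have "const (Poly_Mapping.single (expo s) 1) * var e \<approx> const (Poly_Mapping.single (expo t) 1) * var e'"
    using assms by (intro linear_binomial single_expo_in) (simp_all add: gen_def mult_single expo_add[symmetric])
  then show ?thesis
    using cg_mmon_add[of s "{#e#}" t "{#e'#}" "{#}" B] assms(5) by (simp add: eq)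
qed

text \<open>The Rees map sends monomials to monomials, so it vanishes on \<open>F\<close> only if
  the coefficients of the terms with a common image sum to zero. Such an \<open>F\<close> is a
  combination of differences of monomials with the same image.\<close>

lemma binomials_imp_rees_relations:
  assumes binomials: "\<And>a B c D. set_mset a \<subseteq> {1..n} \<Longrightarrow> set_mset c \<subseteq> {1..n} \<Longrightarrow>
      set_mset B \<subseteq> E \<Longrightarrow> set_mset D \<subseteq> E \<Longrightarrow> size B = size D \<Longrightarrow>
      a + vdeg B = c + vdeg D \<Longrightarrow> mmon a B \<approx> mmon c D"
  shows "rees_relations A E gen \<subseteq> Q"
proof
  fix F assume F: "F \<in> rees_relations A E (gen :: nat set \<Rightarrow> (nat, 'k) mpoly)"
  then have FT: "F \<in> mpolys E A"
    and F0: "subst (\<lambda>a. [:a:]) (\<lambda>j. monom (gen j) (Suc 0)) F = 0"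
    by (auto simp: rees_relations_def)
  \<comment> \<open>A pair \<open>p = (B, a)\<close> stands for the term x^a y^B of
    \<open>F\<close>, with coefficient \<open>c p\<close> in the field; \<open>key p\<close> encodes
    its image under the Rees map.\<close>
  define c where "c p = Poly_Mapping.lookup (Poly_Mapping.lookup F (expo (fst p))) (expo (snd p))" for p
  define P where "P = Sigma (expo -` Poly_Mapping.keys F)
    (\<lambda>B. expo -` Poly_Mapping.keys (Poly_Mapping.lookup F (expo B)))"
  define mm where "mm p = (mmon (snd p) (fst p) :: (nat set, (nat, 'k) mpoly) mpoly)" for p
  define C where "C p = (const (const (c p)) :: (nat set, (nat, 'k) mpoly) mpoly)" for p
  define key where "key p = (snd p + vdeg (fst p), size (fst p))" for p :: "nat set multiset \<times> nat multiset"
  have finP: "finite P" unfolding P_def by (intro finite_SigmaI expo_vimage)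
  have C_mm: "C p * mm p =
      Poly_Mapping.single (expo (fst p)) (Poly_Mapping.single (expo (snd p)) (c p))" for p
    by (simp add: C_def mm_def mmon_def const_def mult_single)
  have F_eq: "F = (\<Sum>p\<in>P. C p * mm p)"
  proof -
    have "F = (\<Sum>B\<in>expo -` Poly_Mapping.keys F. Poly_Mapping.single (expo B) (Poly_Mapping.lookup F (expo B)))"
      by (rule sum_single_expo[symmetric])
    also have "\<dots> = (\<Sum>B\<in>expo -` Poly_Mapping.keys F.
        \<Sum>a\<in>expo -` Poly_Mapping.keys (Poly_Mapping.lookup F (expo B)). C (B, a) * mm (B, a))"
    proof (rule sum.cong[OF refl])
      fix B :: "nat set multiset"
      show "Poly_Mapping.single (expo B) (Poly_Mapping.lookup F (expo B)) =
          (\<Sum>a\<in>expo -` Poly_Mapping.keys (Poly_Mapping.lookup F (expo B)). C (B, a) * mm (B, a))"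
        by (subst sum_single_expo[of "Poly_Mapping.lookup F (expo B)", symmetric])
          (simp only: single_sum C_mm c_def fst_conv snd_conv)
    qed
    also have "\<dots> = (\<Sum>p\<in>P. C p * mm p)"
      unfolding P_def by (subst sum.Sigma) (auto simp: expo_vimage)
    finally show ?thesis .
  qed
  interpret H: ring_hom_on_type "subst (\<lambda>a. [:a:]) (\<lambda>j. monom (gen j :: (nat, 'k) mpoly) (Suc 0))"
    by (rule pCons.subst_hom)
  have fibre_zero: "(\<Sum>p\<in>{p \<in> P. key p = \<kappa>}. c p) = 0" for \<kappa>
  proof -
    obtain \<gamma> d where \<kappa>: "\<kappa> = (\<gamma>, d)" by (cases \<kappa>)
    have "subst (\<lambda>a. [:a:]) (\<lambda>j. monom (gen j) (Suc 0)) (C p * mm p)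
        = monom (Poly_Mapping.single (expo (fst (key p))) (c p)) (snd (key p))" for p
      by (simp add: C_mm pCons.subst_single monom_eval_expo prod_rees_gen smult_monom mult_single
          expo_add key_def)
    then have "0 = (\<Sum>p\<in>P. monom (Poly_Mapping.single (expo (fst (key p))) (c p)) (snd (key p)))"
      using F0 by (simp add: F_eq H.hom_sum)
    \<comment> \<open>Reading off the coefficient of x^\<gamma> t^d selects exactly the terms with
      key \<kappa>.\<close>
    from arg_cong[OF this, of "\<lambda>q. Poly_Mapping.lookup (coeff q d) (expo \<gamma>)"]
    have "0 = (\<Sum>p\<in>P. Poly_Mapping.lookup
        (if d = snd (key p) then Poly_Mapping.single (expo (fst (key p))) (c p) else 0) (expo \<gamma>))"
      by (simp add: coeff_sum lookup_sum eq_commute[of d])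
    also have "\<dots> = (\<Sum>p\<in>P. if key p = \<kappa> then c p else 0)"
      by (rule sum.cong) (auto simp: \<kappa> lookup_single when_def prod_eq_iff)
    also have "\<dots> = (\<Sum>p\<in>{p \<in> P. key p = \<kappa>}. c p)"
      using finP by (intro sum.inter_filter[symmetric])
    finally show ?thesis by simp
  qed
  define rep where "rep \<kappa> = (SOME p. p \<in> P \<and> key p = \<kappa>)" for \<kappa>
  have rep: "rep (key p) \<in> P" "key (rep (key p)) = key p" if "p \<in> P" for p
    unfolding rep_def using someI[of "\<lambda>q. q \<in> P \<and> key q = key p" p] that by auto
  \<comment> \<open>With each term replaced by the representative of its fibre the sum is zero, so
    it may be subtracted from \<open>F\<close>.\<close>
  have "(\<Sum>p\<in>P. C p * mm (rep (key p))) = (\<Sum>\<kappa>\<in>key ` P. \<Sum>p\<in>{p \<in> P. key p = \<kappa>}. C p * mm (rep (key p)))"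
    using finP by (rule sum.image_gen)
  also have "\<dots> = (\<Sum>\<kappa>\<in>key ` P. const (const (\<Sum>p\<in>{p \<in> P. key p = \<kappa>}. c p)) * mm (rep \<kappa>))"
    by (intro sum.cong refl) (simp add: C_def const_sum sum_distrib_right)
  also have "\<dots> = 0" by (simp add: fibre_zero const_zero)
  finally have "F = (\<Sum>p\<in>P. C p * (mm p - mm (rep (key p))))"
    by (simp add: F_eq right_diff_distrib sum_subtractf)
  also have "\<dots> \<in> Q"
  proof (intro TT.ideal_sum[OF Q] TT.ideal_mult[OF Q])
    fix p assume p: "p \<in> P"
    show "C p \<in> mpolys E A"
      unfolding C_def A_eq by (intro A.const_in[unfolded A_eq]) (simp add: const_def mpolys_single)
    have PE: "set_mset (fst q) \<subseteq> E" "set_mset (snd q) \<subseteq> {1..n}" if "q \<in> P" for q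
    proof -
      have 1: "expo (fst q) \<in> Poly_Mapping.keys F"
        "expo (snd q) \<in> Poly_Mapping.keys (Poly_Mapping.lookup F (expo (fst q)))"
        using that by (auto simp: P_def)
      then have "Poly_Mapping.keys (expo (fst q)) \<subseteq> E" "Poly_Mapping.lookup F (expo (fst q)) \<in> A"
        using FT by (auto simp: mpolys_def)
      moreover from this(2) have "Poly_Mapping.keys (expo (snd q)) \<subseteq> {1..n}"
        using 1(2) by (auto simp: A_eq mpolys_def)
      ultimately show "set_mset (fst q) \<subseteq> E" "set_mset (snd q) \<subseteq> {1..n}"
        by (simp_all add: keys_expo)
    qed
    have "key p = key (rep (key p))" using rep(2)[OF p] by simp
    then show "mm p - mm (rep (key p)) \<in> Q"
      unfolding cg_def[symmetric] mm_def
      using PE[OF p] PE[OF rep(1)[OF p]] by (intro binomials) (auto simp: key_def)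
  qed
  finally show "F \<in> Q" .
qed

text \<open>Induction on the size of \<open>B\<close>. An alternating closed walk \<Gamma> inside
  \<open>B\<close> and \<open>D\<close> either is a proper part, and the binomial splits into two
  smaller ones, or it exhausts both. In the latter case a failure of primitivity supplies a walk
  that is a proper part, and otherwise the binomial is that of \<Gamma>, a non-trivial walk since
  \<open>B\<close> and \<open>D\<close> differ.\<close>

lemma toric_binomial:
  assumes prim: "\<And>\<Gamma>. \<Gamma> \<in> nontrivial_primitive_walks TYPE((nat, 'k) mpoly) E \<Longrightarrow> walk_binomial \<Gamma> \<in> Q"
    and "set_mset B \<subseteq> E" "set_mset D \<subseteq> E" "vdeg B = vdeg D"
  shows "mmon {#} B \<approx> mmon {#} D"
  using assms(2-)
proof (induction "size B" arbitrary: B D rule: less_induct)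
  case less
  have sz: "size B = size D" using size_vdeg[of B] size_vdeg[of D] less.prems(3) by simp
  have split: "mmon {#} B \<approx> mmon {#} D"
    if \<Gamma>: "even_closed_walk E \<Gamma>" "evs \<Gamma> \<subseteq># B" "ods \<Gamma> \<subseteq># D" "size (evs \<Gamma>) \<noteq> size B" for \<Gamma>
  proof -
    have d: "vdeg (evs \<Gamma>) = vdeg (ods \<Gamma>)" using \<Gamma>(1) by (rule vdeg_closed_walk)
    have sub: "set_mset (evs \<Gamma>) \<subseteq> E" "set_mset (ods \<Gamma>) \<subseteq> E"
      using \<Gamma>(1) set_evs_ods[of \<Gamma>] by (auto simp: even_closed_walk_def)
    have "\<Gamma> \<noteq> []" using \<Gamma>(1) by (auto simp: even_closed_walk_def)
    \<comment> \<open>The remainder \<open>B'\<close> is then smaller than \<open>B\<close>, as the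
      second use of the induction hypothesis requires.\<close>
    then have pos: "size (evs \<Gamma>) > 0" by (cases \<Gamma>) auto
    have lt: "size (evs \<Gamma>) < size B" using \<Gamma>(2,4) size_mset_mono[of "evs \<Gamma>" B] by linarith
    obtain B' D' where B': "B = evs \<Gamma> + B'" and D': "D = ods \<Gamma> + D'"
      using \<Gamma>(2,3) by (auto simp: subset_mset.le_iff_add)
    have "mmon {#} (evs \<Gamma>) \<approx> mmon {#} (ods \<Gamma>)"
      using less.hyps[OF lt sub] d by simp
    then have "mmon {#} (B' + evs \<Gamma>) \<approx> mmon {#} (B' + ods \<Gamma>)"
      using cg_mmon_add[of "{#}" "evs \<Gamma>" "{#}" "ods \<Gamma>" "{#}" B'] less.prems(1) B' by simp
    also have "B' + ods \<Gamma> = ods \<Gamma> + B'" by simp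
    also have "mmon {#} (ods \<Gamma> + B') \<approx> mmon {#} (ods \<Gamma> + D')"
    proof -
      have "mmon {#} B' \<approx> mmon {#} D'"
        using less.hyps[of B' D'] less.prems pos d by (simp add: B' D')
      from cg_mmon_add[OF this, of "{#}" "ods \<Gamma>"] show ?thesis using sub by simp
    qed
    finally show ?thesis by (simp add: B' D' add.commute)
  qed
  show ?case
  proof (cases "B = D")
    case False
    then have "B \<noteq> {#}" using sz by auto
    then obtain \<Gamma> where \<Gamma>: "even_closed_walk E \<Gamma>" "evs \<Gamma> \<subseteq># B" "ods \<Gamma> \<subseteq># D"
      using alternating_closed_walk[OF _ _ less.prems(3) _ less.prems(1,2)] less.prems(1,2)
        is_edges_E is_edges_mono by metis
    show ?thesis
    proof (cases "size (evs \<Gamma>) = size B")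
      case True
      then have eq: "evs \<Gamma> = B" "ods \<Gamma> = D"
        using \<Gamma> sz size_evs_ods(2)[OF even_closed_walk_even[OF \<Gamma>(1)]]
        by (metis mset_subset_size order_less_irrefl subset_mset.le_imp_less_or_eq)+
      show ?thesis
      proof (cases "primitive_walk TYPE((nat, 'k) mpoly) E \<Gamma>")
        case True
        have "\<not> trivial_walk TYPE((nat, 'k) mpoly) \<Gamma>"
          using False by (simp add: trivial_walk_def walk_binomial_eq[OF \<Gamma>(1)] mmon_eq_iff eq)
        then have "walk_binomial \<Gamma> \<in> Q"
          using True by (intro prim) (simp add: nontrivial_primitive_walks_def)
        then show ?thesis by (simp add: walk_binomial_eq[OF \<Gamma>(1)] eq cg_def)
      next
        case False
        then obtain \<Delta> where \<Delta>: "even_closed_walk E \<Delta>"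
          "(walk_binomial \<Delta> :: (nat set, (nat, 'k) mpoly) mpoly) \<noteq> walk_binomial \<Gamma>"
          "(walk_plus \<Delta> :: (nat set, (nat, 'k) mpoly) mpoly) dvd walk_plus \<Gamma>"
          "(walk_minus \<Delta> :: (nat set, (nat, 'k) mpoly) mpoly) dvd walk_minus \<Gamma>"
          using \<Gamma>(1) by (auto simp: primitive_walk_def)
        have sub: "evs \<Delta> \<subseteq># B" "ods \<Delta> \<subseteq># D"
          using mmon_dvd_imp_subset[OF \<Delta>(3)[unfolded walk_binomial_eq(1)[OF \<Delta>(1)] walk_binomial_eq(1)[OF \<Gamma>(1)]]]
            mmon_dvd_imp_subset[OF \<Delta>(4)[unfolded walk_binomial_eq(2)[OF \<Delta>(1)] walk_binomial_eq(2)[OF \<Gamma>(1)]]]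
          by (simp_all add: eq)
        \<comment> \<open>Equal sizes would make both parts of \<Delta> agree with those of
          \<Gamma>, against the difference of the two binomials.\<close>
        have "size (evs \<Delta>) \<noteq> size B"
        proof
          assume "size (evs \<Delta>) = size B"
          then have "evs \<Delta> = B" "ods \<Delta> = D"
            using sub sz size_evs_ods(2)[OF even_closed_walk_even[OF \<Delta>(1)]]
            by (metis mset_subset_size order_less_irrefl subset_mset.le_imp_less_or_eq)+
          then show False using \<Delta>(2) by (simp add: walk_binomial_eq[OF \<Delta>(1)] walk_binomial_eq[OF \<Gamma>(1)] eq)
        qed
        then show ?thesis by (rule split[OF \<Delta>(1) sub])
      qed
    next
      case False
      then show ?thesis by (rule split[OF \<Gamma>])
    qed
  qed simp
qed

text \<open>Induction on the number of \<open>x\<close>- and \<open>y\<close>-factors on the left. A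
  common \<open>x\<close>-variable cancels. Otherwise a variable x_v on the left comes on the right
  from an edge of \<open>D\<close> at \<open>v\<close>; an exchange brings this edge to the left as
  well, where it cancels. Once no \<open>x\<close> remains, \<open>toric_binomial\<close>
  applies.\<close>

lemma monomial_binomial:
  assumes prim: "\<And>\<Gamma>. \<Gamma> \<in> nontrivial_primitive_walks TYPE((nat, 'k) mpoly) E \<Longrightarrow> walk_binomial \<Gamma> \<in> Q"
    and "set_mset a \<subseteq> {1..n}" "set_mset c \<subseteq> {1..n}" "set_mset B \<subseteq> E" "set_mset D \<subseteq> E"
    and "size B = size D" "a + vdeg B = c + vdeg D"
  shows "mmon a B \<approx> mmon c D"
  using assms(2-)
proof (induction "size a + size B" arbitrary: a c B D rule: less_induct)
  case less
  have size_ac: "size a = size c"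
    using arg_cong[OF less.prems(6), of size] less.prems(5) by (simp add: size_vdeg)
  show ?case
  proof (cases "a = {#}")
    case True
    moreover from this size_ac have "c = {#}" by simp
    ultimately show ?thesis using less.prems toric_binomial[OF prim] by simp
  next
    case False
    then obtain v where v: "v \<in># a" by blast
    show ?thesis
    proof (cases "v \<in># c")
      case True
      obtain a' c' where a': "a = {#v#} + a'" and c': "c = {#v#} + c'"
        using v True by (metis add_mset_add_single insert_DiffM union_commute)
      have "mmon a' B \<approx> mmon c' D"
        using less.prems by (intro less.hyps) (auto simp: a' c')
      from cg_mmon_add[OF this, of "{#v#}" "{#}"] show ?thesis
        using less.prems(1) by (simp add: a' c')
    next
      case False
      have "v \<in># c + vdeg D" using v less.prems(6)[symmetric] by simp
      then have "v \<in># vdeg D" using False by simp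
      then obtain w where w: "{v, w} \<in># D"
        by (rule incident_edge) (use less.prems(4) is_edges_E is_edges_mono in blast)
      obtain D' where D': "D = add_mset {v, w} D'" using w by (metis insert_DiffM)
      obtain a' where a': "a = add_mset v a'" using v by (metis insert_DiffM)
      have "a' + vdeg B = c + add_mset w (vdeg D')"
        using less.prems(6) by (simp add: a' D')
      then have "w \<in># a' + vdeg B" by simp
      moreover have "B \<noteq> {#}" using less.prems(5) D' by auto
      \<comment> \<open>If \<open>w\<close> already lies in \<open>a'\<close>, any edge of the
        non-empty \<open>B\<close> serves; otherwise one with end \<open>w\<close> does. Then x_v
        together with x_w covers the edge from \<open>v\<close> to \<open>w\<close>, and
        \<open>t\<close> collects what the exchange leaves over.\<close>
      ultimately have "\<exists>e\<in>#B. w \<in># a' + ends e"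
        by (auto simp: vdeg_def multiset_nonemptyE)
      then obtain e where e: "e \<in># B" "w \<in># a' + ends e" by blast
      obtain B' where B': "B = add_mset e B'" using e by (metis insert_DiffM)
      obtain t where t: "a' + ends e = add_mset w t" using e(2) by (metis insert_DiffM)
      have edges: "e \<in> E" "{v, w} \<in> E" using less.prems(3,4) B' D' by auto
      have "set_mset (a' + ends e) \<subseteq> {1..n}"
        using less.prems(1) ends_subset[OF edges(1)] by (auto simp: a')
      then have t_sub: "set_mset t \<subseteq> {1..n}" by (simp add: t)
      have "mmon a (add_mset e B') \<approx> mmon t (add_mset {v, w} B')"
        using less.prems(1,3) edges t_sub t by (intro move) (auto simp: a' B' add_mset_commute)
      also have "mmon t (add_mset {v, w} B') \<approx> mmon c (add_mset {v, w} D')"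
      proof -
        have "size t = size a" using arg_cong[OF t, of size] by (simp add: a' ends_def)
        moreover have "t + vdeg B' = c + vdeg D'"
          using less.prems(6) t by (simp add: a' B' D' add.assoc[symmetric])
        ultimately have "mmon t B' \<approx> mmon c D'"
          using less.prems t_sub by (intro less.hyps) (auto simp: B' D')
        from cg_mmon_add[OF this, of "{#}" "{#{v, w}#}"] show ?thesis using edges by simp
      qed
      finally show ?thesis by (simp add: B' D')
    qed
  qed
qed

lemma rees_relations_subset:
  assumes "\<And>\<Gamma>. \<Gamma> \<in> nontrivial_primitive_walks TYPE((nat, 'k) mpoly) E \<Longrightarrow> walk_binomial \<Gamma> \<in> Q"
  shows "rees_relations A E gen \<subseteq> Q"
  using monomial_binomial[OF assms] by (intro binomials_imp_rees_relations) auto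

end

section \<open>Neighbours and edges multiply walk binomials into the linear relations\<close>

lemma evs_ods_snoc:
  "evs (xs @ [x]) = (if even (length xs) then add_mset x (evs xs) else evs xs)"
  "ods (xs @ [x]) = (if even (length xs) then ods xs else add_mset x (ods xs))"
proof -
  have "evs (xs @ [x]) = (if even (length xs) then add_mset x (evs xs) else evs xs) \<and>
    ods (xs @ [x]) = (if even (length xs) then ods xs else add_mset x (ods xs))"
    by (induction xs) auto
  then show "evs (xs @ [x]) = (if even (length xs) then add_mset x (evs xs) else evs xs)"
    "ods (xs @ [x]) = (if even (length xs) then ods xs else add_mset x (ods xs))" by auto
qed

lemma walk_snoc: "walk (u # xs @ [v]) = walk (u # xs) @ [{last (u # xs), v}]"
  by (induction xs arbitrary: u) auto

lemma set_walk_subset: "e \<in> set (walk xs) \<Longrightarrow> e \<subseteq> set xs"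
  by (induction xs rule: walk.induct) auto

text \<open>Moving the first edge to the end shifts every position by one; as the length is even,
  this just swaps the two parity classes. The induction rotates once for each vertex of
  \<open>ps\<close> and a last time when \<open>v\<close> comes first.\<close>

lemma rotate_closed_walk:
  assumes "even (length xs)" "last xs = u" "v \<in> set xs"
  obtains ys where "ys \<noteq> []" "even (length ys)" "last ys = v"
    "set (walk (v # ys)) = set (walk (u # xs))"
    "evs (walk (v # ys)) = evs (walk (u # xs)) \<and> ods (walk (v # ys)) = ods (walk (u # xs)) \<or>
     evs (walk (v # ys)) = ods (walk (u # xs)) \<and> ods (walk (v # ys)) = evs (walk (u # xs))"
proof -
  obtain ps qs where "xs = ps @ v # qs" using assms(3) by (auto simp: in_set_conv_decomp)
  then have "\<exists>ys. ys \<noteq> [] \<and> even (length ys) \<and> last ys = v \<and>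
    set (walk (v # ys)) = set (walk (u # xs)) \<and>
    (evs (walk (v # ys)) = evs (walk (u # xs)) \<and> ods (walk (v # ys)) = ods (walk (u # xs)) \<or>
     evs (walk (v # ys)) = ods (walk (u # xs)) \<and> ods (walk (v # ys)) = evs (walk (u # xs)))"
    using assms(1,2)
  proof (induction ps arbitrary: u xs qs)
    case Nil
    then have w: "walk (v # qs @ [v]) = walk (v # qs) @ [{u, v}]" "walk (u # xs) = {u, v} # walk (v # qs)"
      by (simp_all add: walk_snoc del: walk.simps) simp
    show ?case
      using Nil by (intro exI[of _ "qs @ [v]"]) (auto simp: w evs_ods_snoc)
  next
    case (Cons w ps)
    let ?zs = "ps @ v # qs @ [w]"
    have w: "walk (w # ?zs) = walk (w # ps @ v # qs) @ [{u, w}]"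
      "walk (u # xs) = {u, w} # walk (w # ps @ v # qs)"
      using Cons.prems walk_snoc[of w "ps @ v # qs" w] by auto
    have "evs (walk (w # ?zs)) = ods (walk (u # xs))" "ods (walk (w # ?zs)) = evs (walk (u # xs))"
      "set (walk (w # ?zs)) = set (walk (u # xs))"
      using Cons.prems(1,2) unfolding w by (auto simp: evs_ods_snoc)
    then show ?case
      using Cons.IH[of ?zs "qs @ [w]" w] Cons.prems by auto
  qed
  then show thesis using that by blast
qed

context edge_quotient
begin

section \<open>Exchanges along a walk\<close>

lemma vertex_in: "{i, j} \<in> E \<Longrightarrow> i \<in> {1..n} \<and> j \<in> {1..n}"
  using ends_subset[of "{i, j}"] by simp

text \<open>Two edges are treated at a time. After the induction hypothesis has carried the
  \<open>x\<close>-variable from the far end to \<open>y\<close>, the edge from \<open>w\<close> to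
  \<open>x\<close> is exchanged for the edge from \<open>x\<close> to \<open>y\<close>, which turns
  x_y into x_w.\<close>

lemma path_binomial:
  assumes "even (length xs)" "set (walk (w # xs)) \<subseteq> E" "w \<in> {1..n}"
  shows "mmon {#last (w # xs)#} (evs (walk (w # xs))) \<approx> mmon {#w#} (ods (walk (w # xs)))"
  using assms
proof (induction "length xs" arbitrary: xs w rule: less_induct)
  case less
  show ?case
  proof (cases xs)
    case (Cons x ys)
    with less.prems(1) obtain y zs where xs: "xs = x # y # zs" by (cases ys) auto
    let ?P = "evs (walk (y # zs))" and ?N = "ods (walk (y # zs))"
    have edges: "{w, x} \<in> E" "{x, y} \<in> E" "set (walk (y # zs)) \<subseteq> E"
      using less.prems(2) by (auto simp: xs)
    have y: "y \<in> {1..n}" using vertex_in[OF edges(2)] by simp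
    have "mmon {#last (y # zs)#} ?P \<approx> mmon {#y#} ?N"
      using less.prems(1) y edges by (intro less.hyps) (auto simp: xs)
    from cg_mmon_add[OF this, of "{#}" "{#{w, x}#}"] edges
    have "mmon {#last (w # xs)#} (evs (walk (w # xs))) \<approx> mmon {#y#} (add_mset {w, x} ?N)"
      by (simp add: xs)
    also have "\<dots> \<approx> mmon {#w#} (add_mset {x, y} ?N)"
      using edges less.prems(3) y set_evs_ods[of "walk (y # zs)"] by (intro move) auto
    finally show ?thesis by (simp add: xs)
  qed simp
qed

text \<open>The edge at \<open>i\<close> temporarily replaces the first edge of the closed walk.
  This frees the variable x_w needed to run along the inner path from \<open>w\<close> to
  \<open>t\<close>; the auxiliary edge is then exchanged for the last edge, from \<open>t\<close> to
  \<open>u\<close>, restoring the original \<open>x\<close>-factor.\<close>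

lemma closed_walk_from:
  assumes "xs \<noteq> []" "even (length xs)" "last xs = u" "set (walk (u # xs)) \<subseteq> E"
  shows "{i, u} \<in> E \<Longrightarrow> mmon {#i#} (evs (walk (u # xs))) \<approx> mmon {#i#} (ods (walk (u # xs)))"
    and "{i, j} \<in> E \<Longrightarrow> mmon {#i, j#} (evs (walk (u # xs))) \<approx> mmon {#i, j#} (ods (walk (u # xs)))"
proof -
  have "butlast xs \<noteq> []" using assms(1,2) by (cases xs) auto
  then obtain w ys where "butlast xs = w # ys" by (cases "butlast xs") auto
  then have xs: "xs = w # ys @ [u]" using assms(1,3) by (metis append_Cons append_butlast_last_id)
  have ys: "even (length ys)" using assms(2) by (simp add: xs)
  define t where "t = last (w # ys)"
  \<comment> \<open>The inner path starts at position 1 of the closed walk, so its odd positions are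
    the even ones of the whole.\<close>
  define P where "P = ods (walk (w # ys))"
  define N where "N = evs (walk (w # ys))"
  have \<Gamma>: "walk (u # xs) = {u, w} # walk (w # ys) @ [{t, u}]"
    by (simp only: xs walk.simps walk_snoc t_def)
  have eq: "evs (walk (u # xs)) = add_mset {u, w} P" "ods (walk (u # xs)) = add_mset {t, u} N"
    using ys by (simp_all add: \<Gamma> evs_ods_snoc P_def N_def)
  have edges: "{u, w} \<in> E" "{t, u} \<in> E" "set (walk (w # ys)) \<subseteq> E"
    using assms(4) unfolding \<Gamma> by auto
  have in_n: "u \<in> {1..n}" "w \<in> {1..n}" "t \<in> {1..n}"
    using vertex_in[OF edges(1)] vertex_in[OF edges(2)] by auto
  have sub: "set_mset P \<subseteq> E" "set_mset N \<subseteq> E"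
    using edges(3) set_evs_ods[of "walk (w # ys)"] by (auto simp: P_def N_def)
  have path: "mmon {#w#} P \<approx> mmon {#t#} N"
    unfolding P_def N_def t_def by (rule cg_sym, rule path_binomial[OF ys edges(3) in_n(2)])
  show "mmon {#i#} (evs (walk (u # xs))) \<approx> mmon {#i#} (ods (walk (u # xs)))" if iu: "{i, u} \<in> E"
  proof -
    have i: "i \<in> {1..n}" using vertex_in[OF iu] by simp
    have "mmon {#i#} (add_mset {u, w} P) \<approx> mmon {#w#} (add_mset {i, u} P)"
      using iu edges in_n i sub by (intro move) auto
    also have "\<dots> \<approx> mmon {#t#} (add_mset {i, u} N)"
      using cg_mmon_add[OF path, of "{#}" "{#{i, u}#}"] iu by simp
    also have "\<dots> \<approx> mmon {#i#} (add_mset {t, u} N)"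
      using iu edges in_n i sub by (intro move) auto
    finally show ?thesis by (simp add: eq)
  qed
  show "mmon {#i, j#} (evs (walk (u # xs))) \<approx> mmon {#i, j#} (ods (walk (u # xs)))" if ij: "{i, j} \<in> E"
  proof -
    have i: "i \<in> {1..n}" "j \<in> {1..n}" using vertex_in[OF ij] by auto
    have "mmon {#i, j#} (add_mset {u, w} P) \<approx> mmon {#u, w#} (add_mset {i, j} P)"
      using ij edges in_n i sub by (intro move) auto
    also have "\<dots> \<approx> mmon {#u, t#} (add_mset {i, j} N)"
      using cg_mmon_add[OF path, of "{#u#}" "{#{i, j}#}"] ij in_n by (simp add: add_mset_commute)
    also have "\<dots> \<approx> mmon {#i, j#} (add_mset {t, u} N)"
      using ij edges in_n i sub by (intro move) auto
    finally show ?thesis by (simp add: eq)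
  qed
qed

text \<open>The walk is rotated to start at \<open>v\<close>. The rotation may swap the two
  monomials, which symmetry of the congruence absorbs.\<close>

lemma neighbour_walk_binomial:
  assumes "even_closed_walk E \<Gamma>" "v \<in> walk_vertices \<Gamma>" "{i, v} \<in> E"
  shows "mmon {#i#} (evs \<Gamma>) \<approx> mmon {#i#} (ods \<Gamma>)"
proof -
  obtain u xs where xs: "xs \<noteq> []" "even (length xs)" "last xs = u" "\<Gamma> = walk (u # xs)" "set \<Gamma> \<subseteq> E"
    using assms(1) by (auto simp: even_closed_walk_iff)
  have "v \<in> set (u # xs)"
    using assms(2) set_walk_subset[of _ "u # xs"] unfolding walk_vertices_def xs(4) by blast
  then have "v \<in> set xs" using xs(1,3) by auto
  then obtain ys where ys: "ys \<noteq> []" "even (length ys)" "last ys = v"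
    "set (walk (v # ys)) = set \<Gamma>"
    "evs (walk (v # ys)) = evs \<Gamma> \<and> ods (walk (v # ys)) = ods \<Gamma> \<or>
     evs (walk (v # ys)) = ods \<Gamma> \<and> ods (walk (v # ys)) = evs \<Gamma>"
    using rotate_closed_walk[OF xs(2,3)] unfolding xs(4) by blast
  have "mmon {#i#} (evs (walk (v # ys))) \<approx> mmon {#i#} (ods (walk (v # ys)))"
    using ys xs(5) assms(3) by (intro closed_walk_from(1)) auto
  then show ?thesis using ys(5) cg_sym by auto
qed

lemma edge_walk_binomial:
  assumes "even_closed_walk E \<Gamma>" "{i, j} \<in> E"
  shows "mmon {#i, j#} (evs \<Gamma>) \<approx> mmon {#i, j#} (ods \<Gamma>)"
  using assms closed_walk_from(2) by (fastforce simp: even_closed_walk_iff)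

lemma monomial_times_walk_binomial:
  assumes \<Gamma>: "even_closed_walk E \<Gamma>" and M: "set_mset M \<subseteq> {1..n}"
    and "(\<exists>e\<in>E. ends e \<subseteq># M) \<or> (\<exists>i\<in>#M. \<exists>v\<in>walk_vertices \<Gamma>. {i, v} \<in> E)"
  shows "mmon M (evs \<Gamma>) \<approx> mmon M (ods \<Gamma>)"
proof -
  have "\<exists>N. N \<subseteq># M \<and> mmon N (evs \<Gamma>) \<approx> mmon N (ods \<Gamma>)"
    using assms(3)
  proof (elim disjE bexE)
    fix e assume e: "e \<in> E" "ends e \<subseteq># M"
    obtain i j where "e = {i, j}" using e(1) by (rule edge_cases)
    with e show ?thesis using edge_walk_binomial[OF \<Gamma>, of i j] by auto
  next
    fix i v assume "i \<in># M" "v \<in> walk_vertices \<Gamma>" "{i, v} \<in> E"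
    then show ?thesis
      using neighbour_walk_binomial[OF \<Gamma>, of v i] by (intro exI[of _ "{#i#}"]) auto
  qed
  then obtain N N' where N: "M = N' + N" "mmon N (evs \<Gamma>) \<approx> mmon N (ods \<Gamma>)"
    by (metis subset_mset.le_iff_add union_commute)
  from cg_mmon_add[OF N(2), of N' "{#}"] M show ?thesis by (simp add: N(1))
qed

end

section \<open>Monomial ideals\<close>

lemma lookup_mult_single_add:
  fixes p :: "('i, 'a::comm_ring_1) mpoly"
  shows "Poly_Mapping.lookup (p * Poly_Mapping.single \<beta> c) (\<alpha> + \<beta>) = Poly_Mapping.lookup p \<alpha> * c"
proof -
  have "p * Poly_Mapping.single \<beta> c =
      (\<Sum>\<gamma>\<in>Poly_Mapping.keys p. Poly_Mapping.single (\<gamma> + \<beta>) (Poly_Mapping.lookup p \<gamma> * c))"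
    by (subst sum_single_keys[symmetric]) (simp add: sum_distrib_right mult_single)
  then have "Poly_Mapping.lookup (p * Poly_Mapping.single \<beta> c) (\<alpha> + \<beta>)
      = (\<Sum>\<gamma>\<in>Poly_Mapping.keys p. if \<gamma> = \<alpha> then Poly_Mapping.lookup p \<gamma> * c else 0)"
    by (auto simp: lookup_sum lookup_single when_def intro!: sum.cong)
  also have "\<dots> = Poly_Mapping.lookup p \<alpha> * c" by (simp add: in_keys_iff)
  finally show ?thesis .
qed

context edge_graph
begin

text \<open>The ideals of the theorem are monomial, so membership is a condition on the single
  monomials of a polynomial, and sums and intersections of the ideals become disjunctions and
  conjunctions of \<open>P\<close>.\<close>

definition monomials_in :: "(nat multiset \<Rightarrow> bool) \<Rightarrow> (nat, 'k) mpoly set" where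
  "monomials_in P = {p \<in> A. \<forall>M. expo M \<in> Poly_Mapping.keys p \<longrightarrow> P M}"

lemma keys_subset: "p \<in> A \<Longrightarrow> expo M \<in> Poly_Mapping.keys p \<Longrightarrow> set_mset M \<subseteq> {1..n}"
  unfolding A_eq mpolys_def keys_expo[symmetric] by blast

text \<open>Divisibility of every monomial by a member of \<open>S\<close> survives sums and
  multiples. Conversely, each term of such a polynomial is a multiple of a generator.\<close>

lemma monomial_ideal:
  assumes "\<And>N. N \<in> S \<Longrightarrow> set_mset N \<subseteq> {1..n}"
  shows "Idl\<^bsub>ring_on A\<^esub> ((\<lambda>N. Poly_Mapping.single (expo N) 1) ` S) =
    monomials_in (\<lambda>M. \<exists>N\<in>S. N \<subseteq># M)" (is "Idl\<^bsub>_\<^esub> ?G = ?R")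
proof
  have G: "?G \<subseteq> A" by (intro image_subsetI single_expo_in assms)
  show "Idl\<^bsub>ring_on A\<^esub> ?G \<subseteq> ?R"
  proof (rule A.Idl_minimal[OF A.idealI_on])
    show "?R \<subseteq> A" "?G \<subseteq> ?R" "0 \<in> ?R"
      using G by (auto simp: monomials_in_def A.zero_in)
    show "x + y \<in> ?R" if "x \<in> ?R" "y \<in> ?R" for x y
      using that keys_add[of x y] by (fastforce simp: monomials_in_def intro: A.add_in)
    show "a * x \<in> ?R" if a: "a \<in> A" and x: "x \<in> ?R" for a x
    proof -
      have "\<exists>N\<in>S. N \<subseteq># M" if M: "expo M \<in> Poly_Mapping.keys (a * x)" for M
      proof -
        obtain \<alpha> \<beta> where "expo M = \<alpha> + \<beta>" "\<beta> \<in> Poly_Mapping.keys x"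
          using keys_mult[of a x] M by auto
        moreover obtain B where "\<beta> = expo B" by (rule expo_surj)
        ultimately have "B \<subseteq># M" "expo B \<in> Poly_Mapping.keys x"
          using expo_eq_add[of M B \<alpha>] by (auto simp: add.commute)
        moreover from this(2) x obtain N where "N \<in> S" "N \<subseteq># B"
          unfolding monomials_in_def by blast
        ultimately show ?thesis by (meson subset_mset.order_trans)
      qed
      then show ?thesis using a x by (auto simp: monomials_in_def intro: A.mult_in)
    qed
  qed
  note I = A.ideal_Idl[OF G]
  show "?R \<subseteq> Idl\<^bsub>ring_on A\<^esub> ?G"
  proof
    fix p assume p: "p \<in> ?R"
    have "(\<Sum>M\<in>expo -` Poly_Mapping.keys p. Poly_Mapping.single (expo M) (Poly_Mapping.lookup p (expo M)))
      \<in> Idl\<^bsub>ring_on A\<^esub> ?G"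
    proof (rule A.ideal_sum[OF I])
      fix M assume M: "M \<in> expo -` Poly_Mapping.keys p"
      let ?c = "Poly_Mapping.lookup p (expo M)"
      obtain N N' where N: "N \<in> S" "M = N + N'"
        using p M by (auto simp: monomials_in_def subset_mset.le_iff_add)
      have "set_mset N' \<subseteq> {1..n}"
        using keys_subset[of p M] p M N(2) by (auto simp: monomials_in_def)
      then have "Poly_Mapping.single (expo N') ?c * Poly_Mapping.single (expo N) 1 \<in> Idl\<^bsub>ring_on A\<^esub> ?G"
        using N(1) by (intro A.ideal_mult[OF I] single_expo_in A.Idl_self[OF G]) auto
      then show "Poly_Mapping.single (expo M) ?c \<in> Idl\<^bsub>ring_on A\<^esub> ?G"
        by (simp add: mult_single N(2) expo_add add.commute)
    qed
    then show "p \<in> Idl\<^bsub>ring_on A\<^esub> ?G" by (simp only: sum_single_expo)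
  qed
qed

section \<open>The edge ideal and the neighbour ideals as monomial ideals\<close>

definition edge_monomial :: "nat multiset \<Rightarrow> bool" where
  "edge_monomial M \<longleftrightarrow> (\<exists>e\<in>E. ends e \<subseteq># M)"

definition neighbour_monomial :: "nat set \<Rightarrow> nat multiset \<Rightarrow> bool" where
  "neighbour_monomial U M \<longleftrightarrow> (\<exists>i\<in>#M. \<exists>v\<in>U. {i, v} \<in> E)"

lemma vertex_ring_eq: "vertex_ring n = ring_on A"
  by (simp add: vertex_ring_def A_eq)

lemma edge_ideal_gen: "edge_ideal n E = Idl\<^bsub>ring_on A\<^esub> (gen ` E)"
proof -
  have "{var i * var j | i j. {i, j} \<in> E} = (gen ` E :: (nat, 'k) mpoly set)"
  proof
    show "(gen ` E :: (nat, 'k) mpoly set) \<subseteq> {var i * var j | i j. {i, j} \<in> E}"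
    proof clarify
      fix e assume e: "e \<in> E"
      then obtain i j where "e = {i, j}" by (rule edge_cases)
      then show "\<exists>i j. (gen e :: (nat, 'k) mpoly) = var i * var j \<and> {i, j} \<in> E"
        using e gen_pair by blast
    qed
  qed (auto simp: gen_pair[symmetric])
  then show ?thesis by (simp add: edge_ideal_def vertex_ring_eq)
qed

lemma edge_ideal_eq: "edge_ideal n E = monomials_in edge_monomial"
proof -
  have "gen ` E = (\<lambda>N. Poly_Mapping.single (expo N) (1::'k)) ` ends ` E"
    by (simp add: gen_def image_image)
  moreover have "set_mset N \<subseteq> {1..n}" if "N \<in> ends ` E" for N
    using that ends_subset by blast
  note monomial_ideal[OF this]
  ultimately show ?thesis by (simp add: edge_ideal_gen edge_monomial_def[abs_def])
qed

lemma neighbour_ideal_eq: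
  "neighbour_ideal n E \<Gamma> = monomials_in (neighbour_monomial (walk_vertices \<Gamma>))"
proof -
  let ?S = "{{#i#} | i. i \<in> {1..n} \<and> (\<exists>v\<in>walk_vertices \<Gamma>. {i, v} \<in> E)}"
  have "{var i | i. i \<in> {1..n} \<and> (\<exists>v\<in>walk_vertices \<Gamma>. {i, v} \<in> E)} =
      (\<lambda>N. Poly_Mapping.single (expo N) (1::'k)) ` ?S"
    by (force simp: var_def expo_add_mset)
  moreover have "set_mset N \<subseteq> {1..n}" if "N \<in> ?S" for N
    using that by auto
  note monomial_ideal[OF this]
  ultimately have "neighbour_ideal n E \<Gamma> = monomials_in (\<lambda>M. \<exists>N\<in>?S. N \<subseteq># M)"
    by (simp only: neighbour_ideal_def vertex_ring_eq)
  also have "(\<lambda>M. \<exists>N\<in>?S. N \<subseteq># M) = neighbour_monomial (walk_vertices \<Gamma>)"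
    using ends_subset by (fastforce simp: neighbour_monomial_def)
  finally show ?thesis .
qed

lemma ideal_edge_ideal: "ideal (edge_ideal n E) (ring_on A)"
  unfolding edge_ideal_gen by (rule A.ideal_Idl) (auto intro: gen_in)

lemma ideal_neighbour_ideal: "ideal (neighbour_ideal n E \<Gamma>) (ring_on A)"
  unfolding neighbour_ideal_def vertex_ring_eq
  by (rule A.ideal_Idl) (auto simp: A_eq intro!: subring_on.var_in, unfold_locales, auto)

text \<open>A polynomial on the right splits into its terms divisible by an edge monomial and the
  others; each of the others meets all neighbour conditions at once. Intersecting with
  \<open>A\<close> yields the whole ring when \<open>W\<close> is empty.\<close>

lemma sum_ideal_eq:
  "edge_ideal n E <+>\<^bsub>ring_on A\<^esub> (A \<inter> (\<Inter>\<Gamma>\<in>W. neighbour_ideal n E \<Gamma>)) =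
    monomials_in (\<lambda>M. edge_monomial M \<or> (\<forall>\<Gamma>\<in>W. neighbour_monomial (walk_vertices \<Gamma>) M))"
    (is "?L = ?R")
proof
  show "?L \<subseteq> ?R"
  proof
    fix p assume "p \<in> ?L"
    then obtain q r where p: "p = q + r" "q \<in> edge_ideal n E" "r \<in> A"
      "\<And>\<Gamma>. \<Gamma> \<in> W \<Longrightarrow> r \<in> neighbour_ideal n E \<Gamma>" by (auto simp: set_add_def')
    then show "p \<in> ?R"
      using keys_add[of q r]
      by (fastforce simp: edge_ideal_eq neighbour_ideal_eq monomials_in_def intro: A.add_in)
  qed
  show "?R \<subseteq> ?L"
  proof
    fix p assume p: "p \<in> ?R"
    define t where "t M = Poly_Mapping.single (expo M) (Poly_Mapping.lookup p (expo M))" for M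
    let ?K = "expo -` Poly_Mapping.keys p"
    let ?K1 = "{M \<in> ?K. edge_monomial M}" and ?K2 = "{M \<in> ?K. \<not> edge_monomial M}"
    have t_in: "t M \<in> monomials_in P" if "M \<in> ?K" "P M" for M P
    proof -
      have "t M \<in> A"
        using that(1) p unfolding t_def
        by (intro single_expo_in keys_subset[of p]) (auto simp: monomials_in_def)
      then show ?thesis using that(2) by (auto simp: t_def monomials_in_def split: if_splits)
    qed
    have "p = (\<Sum>M\<in>?K. t M)" by (simp add: t_def sum_single_expo)
    also have "\<dots> = (\<Sum>M\<in>?K1 \<union> ?K2. t M)" by (rule sum.cong) auto
    also have "\<dots> = (\<Sum>M\<in>?K1. t M) + (\<Sum>M\<in>?K2. t M)"
      by (intro sum.union_disjoint finite_subset[OF _ expo_vimage(1)[of p]]) auto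
    finally have "p = (\<Sum>M\<in>?K1. t M) + (\<Sum>M\<in>?K2. t M)" .
    moreover have "(\<Sum>M\<in>?K1. t M) \<in> edge_ideal n E"
      by (intro A.ideal_sum[OF ideal_edge_ideal]) (auto simp: edge_ideal_eq intro: t_in)
    moreover have "(\<Sum>M\<in>?K2. t M) \<in> neighbour_ideal n E \<Gamma>" if "\<Gamma> \<in> W" for \<Gamma>
      using that p
      by (intro A.ideal_sum[OF ideal_neighbour_ideal])
        (auto simp: neighbour_ideal_eq intro!: t_in, auto simp: monomials_in_def)
    moreover have "(\<Sum>M\<in>?K2. t M) \<in> A"
      using t_in[of _ "\<lambda>_. True"] by (intro A.sum_in) (auto simp: monomials_in_def)
    ultimately show "p \<in> ?L" by (auto simp: set_add_def')
  qed
qed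

section \<open>The conductor of an edge ideal\<close>

text \<open>The elements that \<open>r\<close> multiplies into \<open>L\<close> form an ideal
  containing \<open>L\<close>. It contains all of \<open>J\<close> as soon as it contains the
  binomials of the non-trivial primitive walks, and this is checked on each monomial of
  \<open>r\<close> by exchanges along the walk.\<close>

lemma monomials_in_subset_conductor:
  "monomials_in (\<lambda>M. edge_monomial M \<or>
      (\<forall>\<Gamma>\<in>nontrivial_primitive_walks TYPE((nat, 'k) mpoly) E. neighbour_monomial (walk_vertices \<Gamma>) M))
    \<subseteq> conductor_on A E gen"
proof
  fix r assume r: "r \<in> monomials_in (\<lambda>M. edge_monomial M \<or>
      (\<forall>\<Gamma>\<in>nontrivial_primitive_walks TYPE((nat, 'k) mpoly) E. neighbour_monomial (walk_vertices \<Gamma>) M))"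
  then have rA: "r \<in> A" by (simp add: monomials_in_def)
  note L = A.ideal_lin_ideal[of E gen]
  interpret L: edge_quotient n E A "lin_ideal A E gen"
    by (intro edge_quotient.intro edge_graph_axioms edge_quotient_axioms.intro L order_refl)
  let ?Q = "{F \<in> mpolys E A. const r * F \<in> lin_ideal A E gen}"
  have "ideal ?Q (ring_on (mpolys E A))"
  proof (rule TT.idealI_on)
    show "a * x \<in> ?Q" if "a \<in> mpolys E A" "x \<in> ?Q" for a x
      using that TT.ideal_mult[OF L, of a "const r * x"] by (auto intro: TT.mult_in simp: mult_ac)
  qed (auto simp: distrib_left intro: TT.add_in TT.zero_in TT.ideal_zero[OF L] TT.ideal_add[OF L])
  moreover have "lin_ideal A E gen \<subseteq> ?Q"
    using TT.ideal_mult[OF L] TT.ideal_subset[OF L] A.const_in[OF rA] by auto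
  ultimately interpret Q: edge_quotient n E A ?Q
    by (intro edge_quotient.intro edge_graph_axioms edge_quotient_axioms.intro)
  have "rees_relations A E gen \<subseteq> ?Q"
  proof (rule Q.rees_relations_subset)
    fix \<Gamma> assume \<Gamma>: "\<Gamma> \<in> nontrivial_primitive_walks TYPE((nat, 'k) mpoly) E"
    then have walk: "even_closed_walk E \<Gamma>"
      by (simp add: nontrivial_primitive_walks_def primitive_walk_def)
    then have sub: "set_mset (evs \<Gamma>) \<subseteq> E" "set_mset (ods \<Gamma>) \<subseteq> E"
      using set_evs_ods[of \<Gamma>] by (auto simp: even_closed_walk_def)
    have "const r * walk_binomial \<Gamma> = (\<Sum>M\<in>expo -` Poly_Mapping.keys r.
        const (const (Poly_Mapping.lookup r (expo M))) * (mmon M (evs \<Gamma>) - mmon M (ods \<Gamma>)))"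
      unfolding walk_binomial_eq[OF walk]
      by (subst sum_single_expo[of r, symmetric])
        (simp add: single_sum sum_subtractf right_diff_distrib sum_distrib_right const_def mmon_def mult_single)
    also have "\<dots> \<in> lin_ideal A E gen"
    proof (intro TT.ideal_sum[OF L] TT.ideal_mult[OF L])
      fix M assume M: "M \<in> expo -` Poly_Mapping.keys r"
      show "const (const (Poly_Mapping.lookup r (expo M))) \<in> mpolys E A"
        by (intro A.const_in) (simp add: A_eq const_def mpolys_single)
      have "edge_monomial M \<or> neighbour_monomial (walk_vertices \<Gamma>) M"
        using M r \<Gamma> by (auto simp: monomials_in_def)
      then show "mmon M (evs \<Gamma>) - mmon M (ods \<Gamma>) \<in> lin_ideal A E gen"
        unfolding L.cg_def[symmetric] using M keys_subset[OF rA]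
        by (intro L.monomial_times_walk_binomial[OF walk])
          (auto simp: edge_monomial_def neighbour_monomial_def)
    qed
    finally show "walk_binomial \<Gamma> \<in> ?Q"
      using sub by (simp add: walk_binomial_eq[OF walk] TT.diff_in mmon_in)
  qed
  then show "r \<in> conductor_on A E gen" using rA by (auto simp: conductor_on_def)
qed

text \<open>Ends of \<open>d\<close> outside \<open>e\<close> must divide x^M. If both are outside,
  x^M is divisible by the edge monomial of \<open>d\<close>; if one is, it is a neighbour of the
  other end, which lies in \<open>e\<close> and so in \<open>U\<close>.\<close>

lemma edge_subset_add_edge:
  assumes "e \<in> E" "d \<in> E" "d \<noteq> e" "ends d \<subseteq># M + ends e" "e \<subseteq> U"
  shows "edge_monomial M \<or> neighbour_monomial U M"
proof -
  obtain u w where e: "e = {u, w}" "ends e = {#u, w#}" using assms(1) by (rule edge_cases)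
  obtain i j where d: "d = {i, j}" "ends d = {#i, j#}" using assms(2) by (rule edge_cases)
  have le: "count {#i, j#} x \<le> count M x + count {#u, w#} x" for x
    using mset_subset_eq_count[OF assms(4), of x] by (simp only: e(2) d(2) count_union)
  have ij: "{i, j} \<in> E" "{j, i} \<in> E" using assms(2) d(1) by (auto simp: insert_commute[of j])
  have in_M: "x \<in># M" if "x \<in> {i, j}" "x \<notin> e" for x
  proof -
    have "count {#u, w#} x = 0" "1 \<le> count {#i, j#} x" using that by (auto simp: e)
    with le[of x] have "0 < count M x" by linarith
    then show ?thesis by simp
  qed
  consider "i \<notin> e" "j \<notin> e" | "i \<in> e" "j \<notin> e" | "i \<notin> e" "j \<in> e" | "i \<in> e" "j \<in> e" by blast
  then show ?thesis
  proof cases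
    case 1
    have "count {#i, j#} x \<le> count M x" for x
      using le[of x] 1 by (cases "x \<in> e") (auto simp: e split: if_splits)
    then have "{#i, j#} \<subseteq># M" by (rule mset_subset_eqI)
    then show ?thesis using assms(2) d(2) unfolding edge_monomial_def by metis
  next
    case 2
    then show ?thesis using in_M[of j] ij assms(5) by (auto simp: neighbour_monomial_def)
  next
    case 3
    then show ?thesis using in_M[of i] ij assms(5) by (auto simp: neighbour_monomial_def)
  next
    case 4
    \<comment> \<open>An edge other than \<open>e\<close> with both ends in \<open>e\<close> is a
      loop at one end of a non-loop. It needs x_i twice while \<open>e\<close> provides it once, so
      x_i divides x^M, and the loop makes \<open>i\<close> its own neighbour.\<close>
    then have "i = j" "u \<noteq> w" using assms(3) by (auto simp: e d)
    then have "count {#i, j#} i = 2" "count {#u, w#} i \<le> 1" by auto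
    with le[of i] have "0 < count M i" by linarith
    then have "i \<in># M" by simp
    then show ?thesis
      unfolding neighbour_monomial_def using ij(1) \<open>i = j\<close> 4 assms(5) by blast
  qed
qed

text \<open>A monomial x^M of \<open>a e\<close> contributes x^M times the edge monomial of
  \<open>e\<close> to the relation. This must cancel against a term for some other edge
  \<open>d\<close>, whose edge monomial therefore divides the same product.\<close>

lemma linear_relation_coefficient:
  assumes "\<And>d. d \<in> E \<Longrightarrow> a d \<in> A" "(\<Sum>d\<in>E. a d * gen d) = 0" "e \<in> E" "e \<subseteq> U"
  shows "a e \<in> monomials_in (\<lambda>M. edge_monomial M \<or> neighbour_monomial U M)"
proof -
  have "edge_monomial M \<or> neighbour_monomial U M" if M: "expo M \<in> Poly_Mapping.keys (a e)" for M
  proof -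
    let ?c = "\<lambda>d. Poly_Mapping.lookup (a d * gen d) (expo (M + ends e))"
    have "?c e \<noteq> 0"
      using M by (simp add: gen_def expo_add lookup_mult_single_add in_keys_iff)
    moreover have "?c e + (\<Sum>d\<in>E - {e}. ?c d) = 0"
      using arg_cong[OF assms(2), of "\<lambda>p. Poly_Mapping.lookup p (expo (M + ends e))"]
      by (simp add: lookup_sum lookup_add sum.remove[OF finite_E assms(3)])
    ultimately have "(\<Sum>d\<in>E - {e}. ?c d) \<noteq> 0" by auto
    then obtain d where d: "d \<in> E - {e}" "?c d \<noteq> 0" by (meson sum.neutral)
    then have "expo (M + ends e) \<in> Poly_Mapping.keys (a d * gen d)" by (simp add: in_keys_iff)
    then obtain \<alpha> where "expo (M + ends e) = \<alpha> + expo (ends d)"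
      using keys_mult[of "a d" "gen d"] by (auto simp: gen_def split: if_splits)
    then have "ends d \<subseteq># M + ends e" using expo_eq_add[of "M + ends e" "ends d" \<alpha>] by (simp add: add.commute)
    then show ?thesis using edge_subset_add_edge[of e d M U] assms d by auto
  qed
  then show ?thesis using assms(1,3) by (simp add: monomials_in_def)
qed

lemma lin_ideal_coefficient:
  assumes "F \<in> lin_ideal A E gen" "\<And>e. e \<in># B \<Longrightarrow> e \<subseteq> U"
    and I: "ideal (monomials_in (\<lambda>M. edge_monomial M \<or> neighbour_monomial U M)) (ring_on A)"
      (is "ideal ?I _")
  shows "Poly_Mapping.lookup F (expo B) \<in> ?I"
proof -
  \<comment> \<open>The claim is extended to all parts \<open>D\<close> of \<open>B\<close> because
    a coefficient of a product at \<open>D\<close> involves coefficients of the factors at parts of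
    \<open>D\<close>. The generators themselves have coefficients only at single edges.\<close>
  have "\<forall>D. D \<subseteq># B \<longrightarrow> Poly_Mapping.lookup F (expo D) \<in> ?I"
    using assms(1)[unfolded lin_ideal_def] A.linear_forms_subset
  proof (induction rule: TT.Idl_induct)
    case (base l)
    then obtain a where l: "l = (\<Sum>d\<in>E. const (a d) * var d)" and a: "\<And>d. d \<in> E \<Longrightarrow> a d \<in> A"
      "(\<Sum>d\<in>E. a d * gen d) = 0" by (auto simp: linear_forms_def)
    show ?case
    proof (intro allI impI)
      fix D assume D: "D \<subseteq># B"
      have "Poly_Mapping.lookup l (expo D) = (\<Sum>d\<in>E. a d when expo {#d#} = expo D)"
        by (simp add: l lookup_sum const_def var_def mult_single lookup_single expo_add_mset)
      also have "\<dots> \<in> ?I"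
      proof (rule A.ideal_sum[OF I])
        fix d assume d: "d \<in> E"
        show "(a d when expo {#d#} = expo D) \<in> ?I"
        proof (cases "{#d#} = D")
          case True
          then have "d \<in># B" using D by auto
          then have "d \<subseteq> U" by (rule assms(2))
          then show ?thesis using linear_relation_coefficient[OF a d] True by simp
        next
          case False
          then show ?thesis by (simp add: A.ideal_zero[OF I])
        qed
      qed
      finally show "Poly_Mapping.lookup l (expo D) \<in> ?I" .
    qed
  next
    case zero
    then show ?case by (simp add: A.ideal_zero[OF I])
  next
    case (add x y)
    then show ?case by (simp add: lookup_add A.ideal_add[OF I])
  next
    case (mult a x)
    show ?case
    proof (intro allI impI)
      fix D assume D: "D \<subseteq># B"
      have "Poly_Mapping.lookup (a * x) (expo D) = (\<Sum>\<alpha>\<in>Poly_Mapping.keys a. \<Sum>\<beta>\<in>Poly_Mapping.keys x.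
          Poly_Mapping.lookup a \<alpha> * Poly_Mapping.lookup x \<beta> when \<alpha> + \<beta> = expo D)"
        unfolding mult_sum_single[of a x] by (simp add: lookup_sum lookup_single)
      also have "\<dots> \<in> ?I"
      proof (intro A.ideal_sum[OF I])
        fix \<alpha> \<beta>
        show "(Poly_Mapping.lookup a \<alpha> * Poly_Mapping.lookup x \<beta> when \<alpha> + \<beta> = expo D) \<in> ?I"
        proof (cases "\<alpha> + \<beta> = expo D")
          case True
          obtain N where N: "\<beta> = expo N" by (rule expo_surj)
          have "N \<subseteq># D" using expo_eq_add[of D N \<alpha>] True N by (simp add: add.commute)
          then have "Poly_Mapping.lookup x \<beta> \<in> ?I"
            using mult(3) D subset_mset.order_trans N by blast
          then show ?thesis
            using True A.ideal_mult[OF I] A.mpolys_lookup[OF mult(1)] by simp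
        next
          case False
          then show ?thesis by (simp add: A.ideal_zero[OF I])
        qed
      qed
      finally show "Poly_Mapping.lookup (a * x) (expo D) \<in> ?I" .
    qed
  qed
  then show ?thesis by blast
qed

lemma ideal_edges_neighbours:
  "ideal (monomials_in (\<lambda>M. edge_monomial M \<or> neighbour_monomial U M)) (ring_on A)"
proof -
  let ?S = "ends ` E \<union> {{#i#} | i. \<exists>v\<in>U. {i, v} \<in> E}"
  have sub: "set_mset N \<subseteq> {1..n}" if "N \<in> ?S" for N
    using that ends_subset by fastforce
  have "edge_monomial M \<or> neighbour_monomial U M \<longleftrightarrow> (\<exists>N\<in>?S. N \<subseteq># M)" for M
    unfolding bex_Un edge_monomial_def neighbour_monomial_def
    by (rule arg_cong2[where f="(\<or>)"]) (auto, metis mset_subset_eq_single)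
  then have "monomials_in (\<lambda>M. edge_monomial M \<or> neighbour_monomial U M) =
      Idl\<^bsub>ring_on A\<^esub> ((\<lambda>N. Poly_Mapping.single (expo N) 1) ` ?S)"
    by (simp only: monomial_ideal[OF sub])
  also have "ideal \<dots> (ring_on A)"
    by (intro A.ideal_Idl image_subsetI single_expo_in sub)
  finally show ?thesis .
qed

text \<open>The two monomials have equal degrees and equally many edges, hence the same image under
  the Rees map.\<close>

lemma walk_binomial_rees:
  assumes "even_closed_walk E \<Gamma>"
  shows "walk_binomial \<Gamma> \<in> rees_relations A E gen"
proof -
  interpret H: ring_hom_on_type "subst (\<lambda>a. [:a:]) (\<lambda>j. monom (gen j :: (nat, 'k) mpoly) (Suc 0))"
    by (rule pCons.subst_hom)
  have sub: "set_mset (evs \<Gamma>) \<subseteq> E" "set_mset (ods \<Gamma>) \<subseteq> E"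
    using assms set_evs_ods[of \<Gamma>] by (auto simp: even_closed_walk_def)
  have "subst (\<lambda>a. [:a:]) (\<lambda>j. monom (gen j) (Suc 0)) (mmon {#} B) =
      monom (Poly_Mapping.single (expo (vdeg B)) (1::'k)) (size B)" for B
    by (simp add: mmon_def pCons.subst_single monom_eval_expo prod_rees_gen)
  then show ?thesis
    using sub vdeg_closed_walk[OF assms] size_evs_ods(2)[OF even_closed_walk_even[OF assms]]
    by (simp add: rees_relations_def walk_binomial_eq[OF assms] H.hom_diff TT.diff_in mmon_in)
qed

text \<open>For \<open>r\<close> in the conductor, \<open>r\<close> times the binomial of \<Gamma>
  lies in \<open>L\<close>. Non-triviality makes its two monomials distinct, so the coefficient at
  h+ is exactly \<open>r\<close>, and \<open>lin_ideal_coefficient\<close> applies with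
  \<open>U\<close> the vertices of \<Gamma>.\<close>

lemma conductor_subset_monomials_in:
  "conductor_on A E gen \<subseteq> monomials_in (\<lambda>M. edge_monomial M \<or>
      (\<forall>\<Gamma>\<in>nontrivial_primitive_walks TYPE((nat, 'k) mpoly) E. neighbour_monomial (walk_vertices \<Gamma>) M))"
proof
  fix r assume r: "r \<in> conductor_on A E (gen :: nat set \<Rightarrow> (nat, 'k) mpoly)"
  have "r \<in> monomials_in (\<lambda>M. edge_monomial M \<or> neighbour_monomial (walk_vertices \<Gamma>) M)"
    if \<Gamma>: "\<Gamma> \<in> nontrivial_primitive_walks TYPE((nat, 'k) mpoly) E" for \<Gamma>
  proof -
    have walk: "even_closed_walk E \<Gamma>" and nontrivial: "\<not> trivial_walk TYPE((nat, 'k) mpoly) \<Gamma>"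
      using \<Gamma> by (auto simp: nontrivial_primitive_walks_def primitive_walk_def)
    have ne: "evs \<Gamma> \<noteq> ods \<Gamma>" using nontrivial by (auto simp: trivial_walk_def walk_binomial_eq[OF walk])
    have "const r * walk_binomial \<Gamma> \<in> lin_ideal A E gen"
      using r walk_binomial_rees[OF walk] by (simp add: conductor_on_def)
    then have "Poly_Mapping.lookup (const r * walk_binomial \<Gamma>) (expo (evs \<Gamma>)) \<in>
        monomials_in (\<lambda>M. edge_monomial M \<or> neighbour_monomial (walk_vertices \<Gamma>) M)"
      using set_evs_ods[of \<Gamma>]
      by (intro lin_ideal_coefficient ideal_edges_neighbours) (auto simp: walk_vertices_def)
    also have "Poly_Mapping.lookup (const r * walk_binomial \<Gamma>) (expo (evs \<Gamma>)) = r"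
      using ne by (simp add: walk_binomial_eq[OF walk] right_diff_distrib lookup_minus const_def mmon_def
          mult_single lookup_single when_def)
    finally show ?thesis .
  qed
  moreover have "r \<in> A" using r by (simp add: conductor_on_def)
  ultimately show "r \<in> monomials_in (\<lambda>M. edge_monomial M \<or>
      (\<forall>\<Gamma>\<in>nontrivial_primitive_walks TYPE((nat, 'k) mpoly) E. neighbour_monomial (walk_vertices \<Gamma>) M))"
    unfolding monomials_in_def by blast
qed

end

theorem theorem3p9:
  fixes n m :: nat
    and E :: "nat set set"
    and f :: "nat \<Rightarrow> (nat, 'k::field) mpoly"
  assumes "loop_graph n E"
    and "\<forall>i\<in>{1..m}. f i \<in> carrier (vertex_ring n)"
    and "Idl\<^bsub>vertex_ring n\<^esub> (f ` {1..m}) = edge_ideal n E"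
  shows "conductor (carrier (vertex_ring n)) m f =
    edge_ideal n E <+>\<^bsub>vertex_ring n\<^esub>
      (carrier (vertex_ring n) \<inter>
        (\<Inter>\<Gamma> \<in> nontrivial_primitive_walks TYPE((nat, 'k) mpoly) E. neighbour_ideal n E \<Gamma>))"
proof -
  define A :: "(nat, 'k) mpoly set" where "A = mpolys {1..n} UNIV"
  interpret edge_graph n E A
    by unfold_locales (simp_all add: assms(1) A_def)
  have f: "f i \<in> A" if "i \<in> {1..m}" for i using assms(2) that by (simp add: vertex_ring_eq)
  then have sub: "f ` {1..m} \<subseteq> A" by auto
  have gens: "Idl\<^bsub>ring_on A\<^esub> (f ` {1..m}) = Idl\<^bsub>ring_on A\<^esub> (gen ` E)"
    using assms(3) by (simp add: vertex_ring_eq edge_ideal_gen)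
  \<comment> \<open>Both families generate the edge ideal, so the change of generators works in
    either direction and the given \<open>f\<close> may be replaced by the edge monomials.\<close>
  have "conductor_on A {1..m} f = conductor_on A E gen"
  proof
    have 1: "f i \<in> Idl\<^bsub>ring_on A\<^esub> (gen ` E)" if "i \<in> {1..m}" for i
      using A.Idl_self[OF sub, of "f i"] that by (simp only: gens imageI)
    have 2: "gen e \<in> Idl\<^bsub>ring_on A\<^esub> (f ` {1..m})" if "e \<in> E" for e
      unfolding gens using that gen_in by (intro A.Idl_self) auto
    show "conductor_on A {1..m} f \<subseteq> conductor_on A E gen"
      by (rule A.conductor_on_subset[OF finite_E finite_atLeastAtMost 2 gen_in 1 f])
    show "conductor_on A E gen \<subseteq> conductor_on A {1..m} f"
      by (rule A.conductor_on_subset[OF finite_atLeastAtMost finite_E 1 f 2 gen_in])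
  qed
  also have "\<dots> = monomials_in (\<lambda>M. edge_monomial M \<or>
      (\<forall>\<Gamma>\<in>nontrivial_primitive_walks TYPE((nat, 'k) mpoly) E. neighbour_monomial (walk_vertices \<Gamma>) M))"
    using conductor_subset_monomials_in monomials_in_subset_conductor by (rule subset_antisym)
  finally show ?thesis
    by (simp add: conductor_eq_conductor_on vertex_ring_eq sum_ideal_eq)
qed

end
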